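(* Let $\mathbf{v}_i = v_i^{(1)}\wedge\cdots\wedge v_i^{(d)}\in\bigwedge^d V$, $i=1,\dots,r$, be nonzero decomposable elements (representing points of the Grassmannian $\mathbb{G}(d,V)$), and let $t\in\bigwedge^d V$. The following are equivalent: (1) the tensor $t$ can be written as $t=\sum_{i=1}^r a_i\mathbf{v}_i$ with $a_1,\dots,a_r\in K$; (2) $\bigcap_{i=1}^r \vec{\mathbf{v}}_i^{\perp}\subset t^{\perp}$; (3) $\bigcap_{i=1}^r (\vec{\mathbf{v}}_i^{\perp})_d\subset (t^{\perp})_d$.
   Context: $V$ is a vector space of dimension $n+1$ over an algebraically closed field $K$ of characteristic zero, and $V^*$ is its dual. $\mathbb{G}(d,V)\subset\mathbb{P}(\bigwedge^d V)$ is the Grassmannian of $d$-dimensional subspaces of $V$ in its Plücker embedding. Skew-apolarity action: for $\mathbf{h}=h_1\wedge\cdots\wedge h_s\in\bigwedge^s V^*$ and $\mathbf{w}=w_1\wedge\cdots\wedge w_s\in\bigwedge^s V$ put $\mathbf{h}(\mathbf{w})=\det(h_i(w_j))_{1\le i,j\le s}$. For $\mathbf{v}=v_1\wedge\cdots\wedge v_d\in\bigwedge^d V$ and $0\le s\le d$ put $$\mathbf{h}\cdot\mathbf{v}=\sum_{R\subset\{1,\dots,d\},\,|R|=s}\mathrm{sign}(R)\,\mathbf{h}(\mathbf{v}_R)\,\mathbf{v}_{\bar R}\in\textstyle\bigwedge^{d-s}V,$$ where $\bar R=\{1,\dots,d\}\setminus R$, $\mathbf{v}_R$ and $\mathbf{v}_{\bar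 R}$ are the wedge products of the $v_j$ with $j\in R$, respectively $j\in\bar R$, in increasing order, and $\mathrm{sign}(R)$ is the sign of the permutation listing the elements of $R$ increasingly followed by those of $\bar R$ increasingly. This is extended bilinearly to an action $\bigwedge^sV^*\times\bigwedge^dV\to\bigwedge^{d-s}V$; for $s>d$ the action is zero. For $t\in\bigwedge^d V$, $t^{\perp}=\{\mathbf{h}\in\bigwedge^{\bullet}V^*\mid \mathbf{h}\cdot t=0\}$, and $(t^\perp)_d=t^\perp\cap\bigwedge^dV^*$. For a nonzero decomposable $\mathbf{v}=v_1\wedge\cdots\wedge v_d$, $\vec{\mathbf{v}}=\langle v_1,\dots,v_d\rangle\subset V$ is the corresponding $d$-dimensional subspace, $\vec{\mathbf{v}}^{\perp}\subset\bigwedge^{\bullet}V^*$ denotes the ideal of the exterior algebra generated by the linear forms in $V^*$ vanishing on $\vec{\mathbf{v}}$, and $(\vec{\mathbf{v}}^{\perp})_s=\vec{\mathbf{v}}^{\perp}\cap\bigwedge^sV^*$. *)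

theory Defs
  imports
    "HOL-Library.Poly_Mapping"
    "HOL-Library.Function_Algebras"
    "HOL-Algebra.QuotRing"
    "HOL-Combinatorics.Permutations"
    "Jordan_Normal_Form.Determinant"
begin

section \<open>The free associative algebra\<close>

text \<open>With concatenation as addition on lists, the convolution product of
  \<^theory>\<open>HOL-Library.Poly_Mapping\<close> makes \<open>'a list \<Rightarrow>\<^sub>0 'k\<close> the free associative
  \<open>'k\<close>-algebra on \<open>'a\<close>: words are its basis, and the scalar \<open>c\<close> is \<open>single [] c\<close>.\<close>

instantiation list :: (type) monoid_add
begin

definition zero_list :: "'a list" where "zero_list = []"

definition plus_list :: "'a list \<Rightarrow> 'a list \<Rightarrow> 'a list" where "plus_list xs ys = xs @ ys"

instance by standard (simp_all add: zero_list_def plus_list_def)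

end

definition free_algebra :: "'a set \<Rightarrow> ('a list \<Rightarrow>\<^sub>0 'k::field) ring" where
  "free_algebra S =
    \<lparr>carrier = {p. Poly_Mapping.keys p \<subseteq> lists S},
     monoid.mult = (*), one = 1, zero = 0, add = (+)\<rparr>"

lemma ring_free_algebra: "Ring.ring (free_algebra S :: ('a list \<Rightarrow>\<^sub>0 'k::field) ring)"
proof -
  have *: "Poly_Mapping.keys (p + q) \<subseteq> lists S"
    if "Poly_Mapping.keys p \<subseteq> lists S" "Poly_Mapping.keys q \<subseteq> lists S"
    for p q :: "'a list \<Rightarrow>\<^sub>0 'k"
    using that Poly_Mapping.keys_add[of p q] by blast
  have **: "Poly_Mapping.keys (p * q) \<subseteq> lists S"
    if "Poly_Mapping.keys p \<subseteq> lists S" "Poly_Mapping.keys q \<subseteq> lists S"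
    for p q :: "'a list \<Rightarrow>\<^sub>0 'k"
    using that keys_mult[of p q] by (fastforce simp: plus_list_def)
  have ***: "\<exists>q. Poly_Mapping.keys q \<subseteq> lists S \<and> q + p = 0"
    if "Poly_Mapping.keys p \<subseteq> lists S" for p :: "'a list \<Rightarrow>\<^sub>0 'k"
    using that by (intro exI[of _ "- p"]) simp
  show ?thesis
    by (rule ringI; (rule abelian_groupI monoidI)?)
       (use * ** *** in \<open>auto simp: free_algebra_def algebra_simps zero_list_def\<close>)
qed

section \<open>The exterior algebra of a vector space\<close>

text \<open>The vector space is the subspace \<open>S\<close> of the ambient type, with scalar multiplication
  \<open>sc\<close>; the first two families of relations turn the free algebra into the tensor algebra.\<close>

definition exterior_relations ::
  "('k::field \<Rightarrow> 'a::ab_group_add \<Rightarrow> 'a) \<Rightarrow> 'a set \<Rightarrow> ('a list \<Rightarrow>\<^sub>0 'k) set" where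
  "exterior_relations sc S =
     {Poly_Mapping.single [x + y] 1 - Poly_Mapping.single [x] 1 - Poly_Mapping.single [y] 1
        | x y. x \<in> S \<and> y \<in> S} \<union>
     {Poly_Mapping.single [sc c x] 1 - Poly_Mapping.single [x] c | c x. x \<in> S} \<union>
     {Poly_Mapping.single [x, x] 1 | x. x \<in> S}"

definition exterior_ideal ::
  "('k::field \<Rightarrow> 'a::ab_group_add \<Rightarrow> 'a) \<Rightarrow> 'a set \<Rightarrow> ('a list \<Rightarrow>\<^sub>0 'k) set" where
  "exterior_ideal sc S = Idl\<^bsub>free_algebra S\<^esub> (exterior_relations sc S)"

definition exterior_algebra ::
  "('k::field \<Rightarrow> 'a::ab_group_add \<Rightarrow> 'a) \<Rightarrow> 'a set \<Rightarrow> ('a list \<Rightarrow>\<^sub>0 'k) set ring" where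
  "exterior_algebra sc S = free_algebra S Quot exterior_ideal sc S"

definition ext_class ::
  "('k::field \<Rightarrow> 'a::ab_group_add \<Rightarrow> 'a) \<Rightarrow> 'a set \<Rightarrow> ('a list \<Rightarrow>\<^sub>0 'k) \<Rightarrow> ('a list \<Rightarrow>\<^sub>0 'k) set" where
  "ext_class sc S p = exterior_ideal sc S +>\<^bsub>free_algebra S\<^esub> p"

definition ext_power ::
  "('k::field \<Rightarrow> 'a::ab_group_add \<Rightarrow> 'a) \<Rightarrow> 'a set \<Rightarrow> nat \<Rightarrow> ('a list \<Rightarrow>\<^sub>0 'k) set set" where
  "ext_power sc S d =
     {ext_class sc S p | p. p \<in> carrier (free_algebra S) \<and>
        (\<forall>w \<in> Poly_Mapping.keys p. length w = d)}"

definition ext_vec ::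
  "('k::field \<Rightarrow> 'a::ab_group_add \<Rightarrow> 'a) \<Rightarrow> 'a set \<Rightarrow> 'a \<Rightarrow> ('a list \<Rightarrow>\<^sub>0 'k) set" where
  "ext_vec sc S x = ext_class sc S (Poly_Mapping.single [x] 1)"

definition ext_smult ::
  "('k::field \<Rightarrow> 'a::ab_group_add \<Rightarrow> 'a) \<Rightarrow> 'a set \<Rightarrow> 'k \<Rightarrow> ('a list \<Rightarrow>\<^sub>0 'k) set
     \<Rightarrow> ('a list \<Rightarrow>\<^sub>0 'k) set" where
  "ext_smult sc S c t = ext_class sc S (Poly_Mapping.single [] c) \<otimes>\<^bsub>exterior_algebra sc S\<^esub> t"

definition wedge ::
  "('k::field \<Rightarrow> 'a::ab_group_add \<Rightarrow> 'a) \<Rightarrow> 'a set \<Rightarrow> 'a list \<Rightarrow> ('a list \<Rightarrow>\<^sub>0 'k) set" where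
  "wedge sc S xs =
     foldr (\<lambda>x t. ext_vec sc S x \<otimes>\<^bsub>exterior_algebra sc S\<^esub> t) xs \<one>\<^bsub>exterior_algebra sc S\<^esub>"

section \<open>The dual space and its exterior algebra\<close>

definition dual_space ::
  "('k::field \<Rightarrow> 'v::ab_group_add \<Rightarrow> 'v) \<Rightarrow> ('v \<Rightarrow> 'k) set" where
  "dual_space scale = {f. Vector_Spaces.linear scale (*) f}"

definition dual_scale :: "'k::field \<Rightarrow> ('v \<Rightarrow> 'k) \<Rightarrow> 'v \<Rightarrow> 'k" where
  "dual_scale c f = (\<lambda>x. c * f x)"

abbreviation Ext ::
  "('k::field \<Rightarrow> 'v::ab_group_add \<Rightarrow> 'v) \<Rightarrow> ('v list \<Rightarrow>\<^sub>0 'k) set ring" where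
  "Ext scale \<equiv> exterior_algebra scale UNIV"

abbreviation Ext_dual ::
  "('k::field \<Rightarrow> 'v::ab_group_add \<Rightarrow> 'v) \<Rightarrow> (('v \<Rightarrow> 'k) list \<Rightarrow>\<^sub>0 'k) set ring" where
  "Ext_dual scale \<equiv> exterior_algebra dual_scale (dual_space scale)"

section \<open>The skew-apolarity action\<close>

definition pairing_det :: "('v \<Rightarrow> 'k::field) list \<Rightarrow> 'v list \<Rightarrow> 'k" where
  "pairing_det hs ws = det (mat (length hs) (length hs) (\<lambda>(i, j). (hs ! i) (ws ! j)))"

text \<open>Positions are counted from \<open>0\<close>, so \<open>R \<subseteq> {..<d}\<close>.\<close>

definition shuffle_sign :: "nat \<Rightarrow> nat set \<Rightarrow> int" where
  "shuffle_sign d R =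
     sign (\<lambda>i. if i < d then (sorted_list_of_set R @ sorted_list_of_set ({..<d} - R)) ! i else i)"

text \<open>The sum below is empty if there are more linear forms than vectors.\<close>

definition skew_action_word ::
  "('v \<Rightarrow> 'k::field) list \<Rightarrow> 'v list \<Rightarrow> ('v list \<Rightarrow>\<^sub>0 'k)" where
  "skew_action_word hs vs =
     (\<Sum>R | R \<subseteq> {..<length vs} \<and> card R = length hs.
        Poly_Mapping.single (nths vs ({..<length vs} - R))
          (of_int (shuffle_sign (length vs) R) * pairing_det hs (nths vs R)))"

definition skew_action_free ::
  "(('v \<Rightarrow> 'k::field) list \<Rightarrow>\<^sub>0 'k) \<Rightarrow> ('v list \<Rightarrow>\<^sub>0 'k) \<Rightarrow> ('v list \<Rightarrow>\<^sub>0 'k)" where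
  "skew_action_free p q =
     (\<Sum>hs \<in> Poly_Mapping.keys p. \<Sum>vs \<in> Poly_Mapping.keys q.
        Poly_Mapping.single [] (Poly_Mapping.lookup p hs * Poly_Mapping.lookup q vs)
          * skew_action_word hs vs)"

text \<open>The formula for the action is multilinear and alternating both in the linear forms and
  in the vectors, so all members of the following union are the same class; compare
  \<^const>\<open>rcoset_mult\<close>.\<close>

definition skew_action ::
  "('k::field \<Rightarrow> 'v::ab_group_add \<Rightarrow> 'v) \<Rightarrow> (('v \<Rightarrow> 'k) list \<Rightarrow>\<^sub>0 'k) set
     \<Rightarrow> ('v list \<Rightarrow>\<^sub>0 'k) set \<Rightarrow> ('v list \<Rightarrow>\<^sub>0 'k) set" where
  "skew_action scale h t = (\<Union>p\<in>h. \<Union>q\<in>t. ext_class scale UNIV (skew_action_free p q))"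

definition apolar ::
  "('k::field \<Rightarrow> 'v::ab_group_add \<Rightarrow> 'v) \<Rightarrow> ('v list \<Rightarrow>\<^sub>0 'k) set
     \<Rightarrow> (('v \<Rightarrow> 'k) list \<Rightarrow>\<^sub>0 'k) set set" where
  "apolar scale t =
     {h \<in> carrier (Ext_dual scale). skew_action scale h t = \<zero>\<^bsub>Ext scale\<^esub>}"

definition subspace_perp ::
  "('k::field \<Rightarrow> 'v::ab_group_add \<Rightarrow> 'v) \<Rightarrow> 'v set \<Rightarrow> (('v \<Rightarrow> 'k) list \<Rightarrow>\<^sub>0 'k) set set" where
  "subspace_perp scale W =
     Idl\<^bsub>Ext_dual scale\<^esub>
       (ext_vec dual_scale (dual_space scale) ` {f \<in> dual_space scale. \<forall>x\<in>W. f x = 0})"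

end

theory Submission
  imports Defs
begin

text \<open>Write \<open>W\<^sub>i\<close> for the span of the vectors of \<open>v i\<close>. The equivalence rests on the pairing
  \<open>\<langle>h, w\<rangle> = det (h\<^sub>i(w\<^sub>j))\<close> between the exterior powers of degree \<open>d\<close> of the dual space and of the
  space itself, to which the action reduces when both arguments have degree \<open>d\<close>.

  First suppose that \<open>t\<close> is a combination of the \<open>v i\<close>. Each summand of
  the action of \<open>h\<^sub>1 \<and> \<dots> \<and> h\<^sub>s\<close> on a word carries a minor of the matrix of
  the values \<open>h\<^sub>i(w\<^sub>j)\<close>. If some \<open>h\<^sub>i\<close> vanishes on all vectors of the word, every such minor has a zero
  row. Hence the ideal of \<open>W\<^sub>i\<close> annihilates \<open>v i\<close> (\<open>perp_annihilates_word\<close>), and an element of all these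
  ideals annihilates every combination of the \<open>v i\<close>. As classes are cosets of representatives in the
  free algebra, this direction also uses that the action does not depend on representatives
  (\<open>linear_ext_action_dual_ideal\<close>, \<open>skew_action_free_right_ideal\<close>). The only delicate point there is a
  repeated vector: the summands that separate its two copies cancel in pairs, because an adjacent
  transposition changes the sign of a shuffle.

  The inclusion of ideals restricts to degree \<open>d\<close>.

  Finally suppose that the inclusion holds in degree \<open>d\<close>. To show that \<open>t\<close> is a combination of the \<open>v i\<close>,
  one expansion is used twice (\<open>mon_expansion_cong\<close>). If every \<open>x\<close> equals
  \<open>\<Sum>b. \<phi>\<^sub>b(x) e\<^sub>b\<close>, then modulo the exterior relations
  \<open>d! x\<^sub>1 \<dots> x\<^sub>d = \<Sum>w. det (\<phi>\<^bsub>w i\<^esub>(x\<^sub>j)) e\<^bsub>w 1\<^esub> \<dots> e\<^bsub>w d\<^esub>\<close>, where \<open>w\<close> runs over all words of length \<open>d\<close> in the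
  index set. The sum runs over all words and not only over increasing ones, which keeps the induction free of
  sorting; the price is the factor \<open>d!\<close>, which is invertible in characteristic zero.

  Applied to vectors and their coordinates, the expansion shows that the pairing is perfect: a linear
  functional \<open>\<phi>\<close> on the free algebra that kills the exterior ideal is, in degree \<open>d\<close>, the pairing with
  \<open>\<Sum>w. \<phi>(w)/d! w*\<close>, where \<open>w*\<close> is the word of coordinate forms. If \<open>t\<close> is not a combination of the
  \<open>v i\<close>, some such \<open>\<phi>\<close> kills all \<open>v i\<close> but not \<open>t\<close>, so a form \<open>p\<close> pairs to zero with all \<open>v i\<close> but not
  with \<open>t\<close> (\<open>separating_form\<close>).

  Applied to linear forms, with a basis that extends one of \<open>W\<^sub>i\<close>, the expansion shows that \<open>p\<close> lies in
  the ideal of \<open>W\<^sub>i\<close> (\<open>perp_of_vanishing_pairing\<close>): a word with a coordinate form that vanishes on \<open>W\<^sub>i\<close> is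
  in the ideal, and for \<open>w\<close> inside \<open>W\<^sub>i\<close> the coefficient is the pairing of \<open>p\<close> with \<open>w\<close>, which is a
  multiple of its pairing with \<open>v i\<close> and so is zero. Thus \<open>p\<close> contradicts the inclusion.\<close>

section \<open>Linear maps on the free algebra\<close>

abbreviation mon :: "'a list \<Rightarrow> 'k \<Rightarrow> ('a list \<Rightarrow>\<^sub>0 'k::field)" where
  "mon w c \<equiv> Poly_Mapping.single w c"

abbreviation smul :: "'k::field \<Rightarrow> ('a list \<Rightarrow>\<^sub>0 'k) \<Rightarrow> ('a list \<Rightarrow>\<^sub>0 'k)" where
  "smul c p \<equiv> Poly_Mapping.single [] c * p"

lemma mon_mult: "mon u a * mon w b = mon (u @ w) (a * b)"
  by (simp add: mult_single plus_list_def)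

lemma mon_Nil_one: "mon [] 1 = 1"
  by (metis single_one zero_list_def)

lemma mon_sum: "mon w (sum g A) = (\<Sum>x\<in>A. mon w (g x))"
  by (induction A rule: infinite_finite_induct) (simp_all add: single_add)

lemma lookup_smul: "Poly_Mapping.lookup (smul c p) w = c * Poly_Mapping.lookup p w"
proof -
  have "smul c p = Poly_Mapping.map ((*) c) p"
    using mult_map_scale_conv_mult[of c p] by (simp add: zero_list_def)
  then show ?thesis by (simp add: map.rep_eq when_def)
qed

lemma free_algebra_sum_mon:
  "p = (\<Sum>w\<in>Poly_Mapping.keys p. mon w (Poly_Mapping.lookup p w))"
proof (rule poly_mapping_eqI)
  fix w
  have "(\<Sum>u\<in>Poly_Mapping.keys p. Poly_Mapping.lookup (mon u (Poly_Mapping.lookup p u)) w)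
     = (\<Sum>u\<in>Poly_Mapping.keys p. if u = w then Poly_Mapping.lookup p u else 0)"
    by (intro sum.cong) (auto simp: lookup_single when_def)
  also have "\<dots> = Poly_Mapping.lookup p w" by (simp add: in_keys_iff)
  finally show "Poly_Mapping.lookup p w =
      Poly_Mapping.lookup (\<Sum>w\<in>Poly_Mapping.keys p. mon w (Poly_Mapping.lookup p w)) w"
    by (simp add: lookup_sum)
qed

lemma smul_commute: "p * mon [] c = smul c p"
proof -
  have "p * mon [] c = (\<Sum>w\<in>Poly_Mapping.keys p. mon w (Poly_Mapping.lookup p w) * mon [] c)"
    by (subst free_algebra_sum_mon[of p]) (rule sum_distrib_right)
  also have "\<dots> = (\<Sum>w\<in>Poly_Mapping.keys p. smul c (mon w (Poly_Mapping.lookup p w)))"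
    by (simp add: mon_mult mult.commute)
  also have "\<dots> = smul c p"
    by (subst (3) free_algebra_sum_mon[of p]) (rule sum_distrib_left[symmetric])
  finally show ?thesis .
qed

lemma mult_smul_right: "p * smul c q = smul c (p * q)"
  by (metis mult.assoc smul_commute)

lemma mult_smul_left: "smul c p * q = smul c (p * q)"
  by (simp add: mult.assoc)

interpretation free: vector_space "smul :: 'k::field \<Rightarrow> ('a list \<Rightarrow>\<^sub>0 'k) \<Rightarrow> _"
  by standard
    (simp_all add: distrib_left distrib_right single_add mon_Nil_one mon_mult flip: mult.assoc)

lemma keys_smul: "Poly_Mapping.keys (smul c p) \<subseteq> Poly_Mapping.keys p"
  by (auto simp: in_keys_iff lookup_smul)

text \<open>A linear map out of the free algebra is determined by its values on words. The action is
  of this form in each of its arguments, and so is the functional that picks out the scalar part.\<close>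

definition linear_ext ::
  "('a list \<Rightarrow> ('b list \<Rightarrow>\<^sub>0 'k)) \<Rightarrow> ('a list \<Rightarrow>\<^sub>0 'k::field) \<Rightarrow> ('b list \<Rightarrow>\<^sub>0 'k)" where
  "linear_ext f p = (\<Sum>w\<in>Poly_Mapping.keys p. smul (Poly_Mapping.lookup p w) (f w))"

lemma linear_ext_superset:
  assumes "finite A" "Poly_Mapping.keys p \<subseteq> A"
  shows "linear_ext f p = (\<Sum>w\<in>A. smul (Poly_Mapping.lookup p w) (f w))"
  unfolding linear_ext_def using assms
  by (intro sum.mono_neutral_left) (auto simp: in_keys_iff)

lemma linear_ext_add: "linear_ext f (p + q) = linear_ext f p + linear_ext f q"
proof -
  let ?A = "Poly_Mapping.keys p \<union> Poly_Mapping.keys q"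
  have A: "finite ?A" by simp
  show ?thesis
    using linear_ext_superset[OF A, of "p + q" f] linear_ext_superset[OF A, of p f]
      linear_ext_superset[OF A, of q f] Poly_Mapping.keys_add[of p q]
    by (simp add: lookup_add single_add distrib_right sum.distrib)
qed

lemma linear_ext_smul: "linear_ext f (smul c p) = smul c (linear_ext f p)"
  using linear_ext_superset[OF _ keys_smul, of p f c]
  by (simp add: linear_ext_def sum_distrib_left lookup_smul mon_mult flip: mult.assoc)

lemma linear_linear_ext: "Vector_Spaces.linear smul smul (linear_ext f)"
  by unfold_locales (simp_all add: linear_ext_add linear_ext_smul)

lemma linear_ext_zero: "linear_ext f 0 = 0"
  and linear_ext_diff: "linear_ext f (p - q) = linear_ext f p - linear_ext f q"
  and linear_ext_sum: "linear_ext f (sum g A) = (\<Sum>x\<in>A. linear_ext f (g x))"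
proof -
  interpret Vector_Spaces.linear smul smul "linear_ext f" by (rule linear_linear_ext)
  show "linear_ext f 0 = 0"
    "linear_ext f (p - q) = linear_ext f p - linear_ext f q"
    "linear_ext f (sum g A) = (\<Sum>x\<in>A. linear_ext f (g x))"
    by (rule zero diff sum)+
qed

lemma linear_ext_mon: "linear_ext f (mon w c) = smul c (f w)"
  by (cases "c = 0") (simp_all add: linear_ext_def)

lemma linear_ext_in_subspace:
  assumes "free.subspace P" "\<And>w. w \<in> Poly_Mapping.keys p \<Longrightarrow> f w \<in> P"
  shows "linear_ext f p \<in> P"
  unfolding linear_ext_def using assms by (intro free.subspace_sum free.subspace_scale)

section \<open>The exterior ideal\<close>

lemma free_algebra_simps:
  "carrier (free_algebra S) = {p. Poly_Mapping.keys p \<subseteq> lists S}"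
  "p \<otimes>\<^bsub>free_algebra S\<^esub> q = p * q"
  "p \<oplus>\<^bsub>free_algebra S\<^esub> q = p + q"
  "\<one>\<^bsub>free_algebra S\<^esub> = 1"
  "\<zero>\<^bsub>free_algebra S\<^esub> = 0"
  by (simp_all add: free_algebra_def)

lemma mon_in_free_algebra: "w \<in> lists S \<Longrightarrow> mon w c \<in> carrier (free_algebra S)"
  by (cases "c = 0") (auto simp: free_algebra_simps)

lemma subspace_free_algebra: "free.subspace (carrier (free_algebra S))"
proof (rule free.subspaceI)
  show "p + q \<in> carrier (free_algebra S)"
    if "p \<in> carrier (free_algebra S)" "q \<in> carrier (free_algebra S)" for p q
    using that Poly_Mapping.keys_add[of p q] by (auto simp: free_algebra_simps)
  show "smul c p \<in> carrier (free_algebra S)" if "p \<in> carrier (free_algebra S)" for c p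
    using that keys_smul[of c p] by (auto simp: free_algebra_simps)
qed (simp add: free_algebra_simps)

lemma a_inv_free_algebra:
  assumes "p \<in> carrier (free_algebra S)"
  shows "\<ominus>\<^bsub>free_algebra S\<^esub> p = - p"
proof -
  interpret Ring.ring "free_algebra S" by (rule ring_free_algebra)
  have "p \<oplus>\<^bsub>free_algebra S\<^esub> - p = \<zero>\<^bsub>free_algebra S\<^esub>" by (simp add: free_algebra_simps)
  moreover have "- p \<in> carrier (free_algebra S)"
    using assms by (simp add: free_algebra_simps)
  ultimately show ?thesis using assms minus_equality[of "- p" p]
    by (simp add: a_comm)
qed

lemma ideal_free_algebraI:
  assumes "J \<subseteq> carrier (free_algebra S)" "free.subspace J"
    and "\<And>a x. a \<in> carrier (free_algebra S) \<Longrightarrow> x \<in> J \<Longrightarrow> a * x \<in> J"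
    and "\<And>a x. a \<in> carrier (free_algebra S) \<Longrightarrow> x \<in> J \<Longrightarrow> x * a \<in> J"
  shows "ideal J (free_algebra S)"
proof (rule idealI)
  interpret Ring.ring "free_algebra S" by (rule ring_free_algebra)
  show "Ring.ring (free_algebra S)" by (rule ring_free_algebra)
  show "subgroup J (add_monoid (free_algebra S))"
  proof (rule subgroup.intro)
    show "inv\<^bsub>add_monoid (free_algebra S)\<^esub> x \<in> J" if "x \<in> J" for x
      using that assms(1,2) a_inv_free_algebra[of x S]
      by (auto simp: a_inv_def free.subspace_neg)
  qed (use assms(1,2) in \<open>auto simp: free_algebra_simps free.subspace_add free.subspace_0\<close>)
qed (use assms in \<open>auto simp: free_algebra_simps\<close>)

text \<open>Every element of the free algebra is a combination of words, so a condition on the products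
  \<open>a * q * b\<close> needs to be tested on words \<open>a\<close> and \<open>b\<close> only.\<close>

lemma linear_ext_two_sided:
  assumes P: "free.subspace P"
    and words: "\<And>u w. u \<in> lists S \<Longrightarrow> w \<in> lists S \<Longrightarrow> linear_ext f (mon u 1 * q * mon w 1) \<in> P"
    and a: "a \<in> carrier (free_algebra S)" and b: "b \<in> carrier (free_algebra S)"
  shows "linear_ext f (a * q * b) \<in> P"
proof -
  have "a * q * b = (\<Sum>u\<in>Poly_Mapping.keys a. mon u (Poly_Mapping.lookup a u)) * q
      * (\<Sum>w\<in>Poly_Mapping.keys b. mon w (Poly_Mapping.lookup b w))"
    using free_algebra_sum_mon[of a] free_algebra_sum_mon[of b] by simp
  also have "\<dots> = (\<Sum>u\<in>Poly_Mapping.keys a. \<Sum>w\<in>Poly_Mapping.keys b.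
      mon u (Poly_Mapping.lookup a u) * q * mon w (Poly_Mapping.lookup b w))"
    by (simp add: sum_distrib_right sum_distrib_left sum.swap[of _ "Poly_Mapping.keys b"])
  also have "\<dots> = (\<Sum>u\<in>Poly_Mapping.keys a. \<Sum>w\<in>Poly_Mapping.keys b.
      smul (Poly_Mapping.lookup a u) (smul (Poly_Mapping.lookup b w) (mon u 1 * q * mon w 1)))"
  proof (intro sum.cong refl)
    fix u w
    have "mon u (Poly_Mapping.lookup a u) = smul (Poly_Mapping.lookup a u) (mon u 1)"
      "mon w (Poly_Mapping.lookup b w) = smul (Poly_Mapping.lookup b w) (mon w 1)"
      by (simp_all add: mon_mult)
    then show "mon u (Poly_Mapping.lookup a u) * q * mon w (Poly_Mapping.lookup b w)
      = smul (Poly_Mapping.lookup a u) (smul (Poly_Mapping.lookup b w) (mon u 1 * q * mon w 1))"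
      using mult_smul_right[of "mon u 1 * q" "Poly_Mapping.lookup b w" "mon w 1"]
      by (simp only: mult.assoc)
  qed
  finally show ?thesis
    using a b
    by (auto simp: linear_ext_sum linear_ext_smul free_algebra_simps
        intro!: free.subspace_sum[OF P] free.subspace_scale[OF P] words)
qed

text \<open>The exterior algebra is built on a subset of the ambient type. The closure conditions below make the
  exterior relations elements of the free algebra on that subset; both the whole vector space and its
  dual, a set of functions, are instances.\<close>

locale exterior =
  fixes sc :: "'k::field \<Rightarrow> 'a::ab_group_add \<Rightarrow> 'a" and S :: "'a set"
  assumes zero_in: "0 \<in> S" and add_in: "x \<in> S \<Longrightarrow> y \<in> S \<Longrightarrow> x + y \<in> S"
    and scale_in: "x \<in> S \<Longrightarrow> sc c x \<in> S"
begin

abbreviation FA where "FA \<equiv> carrier (free_algebra S :: ('a list \<Rightarrow>\<^sub>0 'k) ring)"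
abbreviation I where "I \<equiv> exterior_ideal sc S"

lemma one_in_FA: "1 \<in> FA"
  by (simp add: free_algebra_simps zero_list_def)

lemma mult_in_FA: "p \<in> FA \<Longrightarrow> q \<in> FA \<Longrightarrow> p * q \<in> FA"
  using monoid.m_closed[OF Ring.ring.is_monoid[OF ring_free_algebra], of p S q]
  by (simp add: free_algebra_simps)

lemma exterior_relations_in_FA: "exterior_relations sc S \<subseteq> FA"
proof -
  show ?thesis
    unfolding exterior_relations_def
    by (auto intro!: free.subspace_diff[OF subspace_free_algebra] mon_in_free_algebra add_in scale_in)
qed

lemma ideal_exterior: "ideal I (free_algebra S)"
  unfolding exterior_ideal_def
  by (rule ring.genideal_ideal[OF ring_free_algebra exterior_relations_in_FA])

sublocale ideal I "free_algebra S" by (rule ideal_exterior)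

lemma I_subset_FA: "I \<subseteq> FA"
  using a_subset by simp

lemma exterior_relations_in_I: "exterior_relations sc S \<subseteq> I"
  unfolding exterior_ideal_def
  by (rule ring.genideal_self[OF ring_free_algebra exterior_relations_in_FA])

lemma mult_I_left: "x \<in> I \<Longrightarrow> a \<in> FA \<Longrightarrow> a * x \<in> I"
  using I_l_closed by (simp add: free_algebra_simps)

lemma mult_I_right: "x \<in> I \<Longrightarrow> a \<in> FA \<Longrightarrow> x * a \<in> I"
  using I_r_closed by (simp add: free_algebra_simps)

lemma subspace_I: "free.subspace I"
proof (rule free.subspaceI)
  show "0 \<in> I" using additive_subgroup.zero_closed[OF additive_subgroup_axioms] unfolding free_algebra_simps .
  show "x + y \<in> I" if "x \<in> I" "y \<in> I" for x y
    using additive_subgroup.a_closed[OF additive_subgroup_axioms that] by (simp add: free_algebra_simps)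
  show "smul c x \<in> I" if "x \<in> I" for c x
    using that by (intro mult_I_left mon_in_free_algebra) auto
qed

lemma exterior_ideal_minimal:
  "ideal J (free_algebra S) \<Longrightarrow> exterior_relations sc S \<subseteq> J \<Longrightarrow> I \<subseteq> J"
  unfolding exterior_ideal_def by (rule ring.genideal_minimal[OF ring_free_algebra])

text \<open>The preimage of a subspace under a linear map is not an ideal in general, but the elements whose
  two-sided multiples all lie in it form one. With this, minimality of a generated ideal reduces a statement about the ideal
  to its generators.\<close>

lemma ideal_linear_ext:
  assumes P: "free.subspace P"
  shows "ideal {q \<in> FA. \<forall>a\<in>FA. \<forall>b\<in>FA. linear_ext f (a * q * b) \<in> P} (free_algebra S)"
proof (rule ideal_free_algebraI)
  let ?J = "{q \<in> FA. \<forall>a\<in>FA. \<forall>b\<in>FA. linear_ext f (a * q * b) \<in> P}"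
  show "free.subspace ?J"
    by (rule free.subspaceI)
      (auto simp: distrib_left distrib_right linear_ext_add linear_ext_zero linear_ext_smul
        mult_smul_left mult_smul_right free.subspace_0[OF P]
        intro: free.subspace_add[OF P] free.subspace_scale[OF P]
          free.subspace_add[OF subspace_free_algebra] free.subspace_scale[OF subspace_free_algebra]
          free.subspace_0[OF subspace_free_algebra])
  show "a * x \<in> ?J" if "a \<in> FA" "x \<in> ?J" for a x
    using that by (auto intro!: mult_in_FA simp flip: mult.assoc)
  show "x * a \<in> ?J" if "a \<in> FA" "x \<in> ?J" for a x
    using that by (auto intro!: mult_in_FA simp: mult.assoc)
qed auto

text \<open>The universal property of the exterior algebra, relative to a subspace \<open>P\<close>: a function on words that is
  multilinear and alternating modulo \<open>P\<close> maps the exterior ideal into \<open>P\<close>. On the side of the linear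
  forms \<open>P\<close> is zero; on the side of the vectors it is the exterior ideal itself.\<close>

lemma linear_ext_alternating:
  assumes P: "free.subspace P"
    and add: "\<And>a b x y. a \<in> lists S \<Longrightarrow> b \<in> lists S \<Longrightarrow> x \<in> S \<Longrightarrow> y \<in> S \<Longrightarrow>
        f (a @ (x + y) # b) - f (a @ x # b) - f (a @ y # b) \<in> P"
    and scale: "\<And>a b c x. a \<in> lists S \<Longrightarrow> b \<in> lists S \<Longrightarrow> x \<in> S \<Longrightarrow>
        f (a @ sc c x # b) - smul c (f (a @ x # b)) \<in> P"
    and alt: "\<And>a b x. a \<in> lists S \<Longrightarrow> b \<in> lists S \<Longrightarrow> x \<in> S \<Longrightarrow> f (a @ x # x # b) \<in> P"
    and q: "q \<in> I"
  shows "linear_ext f q \<in> P"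
proof -
  let ?J = "{q \<in> FA. \<forall>a\<in>FA. \<forall>b\<in>FA. linear_ext f (a * q * b) \<in> P}"
  have "q \<in> ?J" if q: "q \<in> exterior_relations sc S" for q
  proof -
    have "linear_ext f (mon u 1 * q * mon w 1) \<in> P" if "u \<in> lists S" "w \<in> lists S" for u w
      using q that add[of u w] scale[of u w] alt[of u w]
      by (auto simp: exterior_relations_def linear_ext_diff linear_ext_mon mon_mult
          left_diff_distrib right_diff_distrib mon_Nil_one)
    then show ?thesis
      using q exterior_relations_in_FA linear_ext_two_sided[OF P, of S f q] by blast
  qed
  then have "q \<in> ?J"
    using exterior_ideal_minimal[OF ideal_linear_ext[OF P]] q by blast
  then have "linear_ext f (1 * q * 1) \<in> P" using one_in_FA by blast
  then show ?thesis by simp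
qed

text \<open>The scalars survive in the exterior algebra, since the coefficient of the empty word vanishes on
  the exterior ideal. This detects nonzero values of the action in top degree.\<close>

lemma scalar_in_I: "mon [] c \<in> I \<longleftrightarrow> c = 0"
proof
  assume I: "mon [] c \<in> I"
  have "linear_ext (\<lambda>w :: 'a list. if w = [] then mon [] 1 else 0 :: 'a list \<Rightarrow>\<^sub>0 'k) (mon [] c) \<in> {0}"
    by (rule linear_ext_alternating[OF _ _ _ _ I]) auto
  then show "c = 0" by (simp add: linear_ext_mon mon_mult) (metis lookup_single_eq lookup_zero)
qed (simp add: free.subspace_0[OF subspace_I])

lemma in_I_sum: "(\<And>x. x \<in> A \<Longrightarrow> g x \<in> I) \<Longrightarrow> sum g A \<in> I"
  by (rule free.subspace_sum[OF subspace_I])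

end

section \<open>Computing modulo the exterior ideal\<close>

context exterior
begin

definition cong where "cong p q \<longleftrightarrow> p - q \<in> I"

lemma cong_refl [simp]: "cong p p"
  by (simp add: cong_def free.subspace_0[OF subspace_I])

lemma cong_sym: "cong p q \<Longrightarrow> cong q p"
  unfolding cong_def using free.subspace_neg[OF subspace_I] by fastforce

lemma cong_trans [trans]: "cong p q \<Longrightarrow> cong q r \<Longrightarrow> cong p r"
  unfolding cong_def using free.subspace_add[OF subspace_I] by fastforce

lemma cong_add: "cong p q \<Longrightarrow> cong p' q' \<Longrightarrow> cong (p + p') (q + q')"
  unfolding cong_def using free.subspace_add[OF subspace_I] by (fastforce simp: algebra_simps)

lemma cong_smul: "cong p q \<Longrightarrow> cong (smul c p) (smul c q)"
  unfolding cong_def using free.subspace_scale[OF subspace_I, of "p - q" c]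
  by (simp add: right_diff_distrib)

lemma cong_sum: "(\<And>x. x \<in> A \<Longrightarrow> cong (g x) (h x)) \<Longrightarrow> cong (sum g A) (sum h A)"
  unfolding cong_def using in_I_sum[of A "\<lambda>x. g x - h x"] by (simp add: sum_subtractf)

lemma cong_mult_left: "cong p q \<Longrightarrow> a \<in> FA \<Longrightarrow> cong (a * p) (a * q)"
  unfolding cong_def using mult_I_left[of "p - q" a] by (simp add: right_diff_distrib)

lemma cong_mult_right: "cong p q \<Longrightarrow> a \<in> FA \<Longrightarrow> cong (p * a) (q * a)"
  unfolding cong_def using mult_I_right[of "p - q" a] by (simp add: left_diff_distrib)

lemma mon_add_cong:
  assumes "x \<in> S" "y \<in> S"
  shows "cong (mon [x + y] 1) (mon [x] 1 + mon [y] 1)"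
proof -
  have "mon [x + y] 1 - mon [x] 1 - mon [y] 1 \<in> exterior_relations sc S"
    unfolding exterior_relations_def using assms by blast
  then show ?thesis
    using exterior_relations_in_I by (auto simp: cong_def diff_diff_eq)
qed

lemma mon_scale_cong:
  assumes "x \<in> S"
  shows "cong (mon [sc c x] 1) (mon [x] c)"
proof -
  have "mon [sc c x] 1 - mon [x] c \<in> exterior_relations sc S"
    unfolding exterior_relations_def using assms by blast
  then show ?thesis using exterior_relations_in_I by (auto simp: cong_def)
qed

lemma mon_square_cong:
  assumes "x \<in> S"
  shows "cong (mon [x, x] 1) 0"
proof -
  have "mon [x, x] 1 \<in> exterior_relations sc S"
    unfolding exterior_relations_def using assms by blast
  then show ?thesis using exterior_relations_in_I by (auto simp: cong_def)
qed

lemma mon_zero_cong: "cong (mon [0] 1) 0"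
  using mon_add_cong[OF zero_in zero_in] free.subspace_neg[OF subspace_I]
  unfolding cong_def by fastforce

text \<open>Membership of the sum is part of the conclusion because the induction step needs it.\<close>

lemma mon_sum_cong:
  assumes "finite A" "\<And>i. i \<in> A \<Longrightarrow> g i \<in> S"
  shows "cong (mon [\<Sum>i\<in>A. sc (c i) (g i)] 1) (\<Sum>i\<in>A. mon [g i] (c i))
    \<and> (\<Sum>i\<in>A. sc (c i) (g i)) \<in> S"
  using assms
proof (induction A rule: finite_induct)
  case (insert i A)
  then show ?case
    using cong_trans[OF mon_add_cong[of "sc (c i) (g i)" "\<Sum>i\<in>A. sc (c i) (g i)"]
        cong_add[OF mon_scale_cong[of "g i" "c i"]]]
    by (simp add: scale_in add_in)
qed (simp_all add: mon_zero_cong zero_in)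

text \<open>Expand the square of \<open>x + y\<close>; it vanishes, as do the squares of \<open>x\<close> and \<open>y\<close>.\<close>

lemma mon_swap_cong:
  assumes "x \<in> S" "y \<in> S"
  shows "cong (mon [x, y] 1) (- mon [y, x] 1)"
proof -
  have m: "mon [u] 1 \<in> FA" if "u \<in> S" for u using that by (intro mon_in_free_algebra) auto
  have "cong 0 (mon [x + y] 1 * mon [x + y] 1)"
    using cong_sym[OF mon_square_cong[OF add_in[OF assms]]] by (simp add: mon_mult)
  also have "cong \<dots> (mon [x + y] 1 * (mon [x] 1 + mon [y] 1))"
    by (intro cong_mult_left mon_add_cong m add_in assms)
  also have "cong \<dots> ((mon [x] 1 + mon [y] 1) * (mon [x] 1 + mon [y] 1))"
    by (intro cong_mult_right mon_add_cong m assms free.subspace_add[OF subspace_free_algebra])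
  also have "\<dots> = mon [x, x] 1 + (mon [x, y] 1 + mon [y, x] 1) + mon [y, y] 1"
    by (simp add: algebra_simps mon_mult)
  also have "cong \<dots> (0 + (mon [x, y] 1 + mon [y, x] 1) + 0)"
    by (intro cong_add mon_square_cong assms cong_refl)
  finally show ?thesis using cong_sym by (fastforce simp: cong_def)
qed

text \<open>This supplies the sign that the expansion along the first row of a determinant asks for.\<close>

lemma mon_move_front_cong:
  assumes "x \<in> S" "u \<in> lists S" "w \<in> lists S"
  shows "cong (mon (x # u @ w) ((- 1) ^ length u)) (mon (u @ x # w) 1)"
  using assms(2)
proof (induction u)
  case (Cons y u)
  then have y: "y \<in> S" and u: "u \<in> lists S" by auto
  have "mon (x # (y # u) @ w) ((- 1) ^ length (y # u))
      = mon [x, y] 1 * mon (u @ w) (- ((- 1) ^ length u))"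
    by (simp add: mon_mult)
  also have "cong \<dots> (- mon [y, x] 1 * mon (u @ w) (- ((- 1) ^ length u)))"
    using assms u by (intro cong_mult_right mon_swap_cong y mon_in_free_algebra) auto
  also have "\<dots> = mon [y] 1 * mon (x # u @ w) ((- 1) ^ length u)"
    by (simp add: mon_mult single_uminus)
  also have "cong \<dots> (mon [y] 1 * mon (u @ x # w) 1)"
    using y by (intro cong_mult_left Cons.IH u mon_in_free_algebra) auto
  finally show ?case by (simp add: mon_mult)
qed simp

end

section \<open>Classes in the exterior algebra\<close>

context exterior
begin

abbreviation E where "E \<equiv> exterior_algebra sc S"
abbreviation cls where "cls \<equiv> ext_class sc S"

lemma cls_ring_hom: "ring_hom_ring (free_algebra S) E cls"
  using rcos_ring_hom_ring unfolding exterior_algebra_def ext_class_def[abs_def] .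

sublocale cls: ring_hom_ring "free_algebra S" E cls by (rule cls_ring_hom)

lemma zero_E: "\<zero>\<^bsub>E\<^esub> = I"
  by (simp add: exterior_algebra_def FactRing_def)

lemma carrier_E: "carrier E = cls ` FA"
  by (auto simp: exterior_algebra_def FactRing_def A_RCOSETS_def' ext_class_def)

lemma mem_cls_iff: "q \<in> cls p \<longleftrightarrow> q - p \<in> I"
proof -
  have "q \<in> cls p \<longleftrightarrow> (\<exists>i\<in>I. q = i + p)"
    by (simp add: ext_class_def a_r_coset_def' free_algebra_simps)
  then show ?thesis by (metis add_diff_cancel_right' diff_add_cancel)
qed

lemma cls_eq_iff: "cls p = cls q \<longleftrightarrow> cong p q"
proof
  assume "cls p = cls q"
  then show "cong p q" using mem_cls_iff[of p p] mem_cls_iff[of p q] free.subspace_0[OF subspace_I]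
    by (simp add: cong_def)
next
  assume "cong p q"
  then have "r - p \<in> I \<longleftrightarrow> r - q \<in> I" for r
    using cong_trans[of r p q] cong_trans[of r q p] cong_sym[of p q] by (auto simp: cong_def)
  then show "cls p = cls q" by (auto simp: mem_cls_iff)
qed

lemma cls_eq_zero_iff: "cls p = \<zero>\<^bsub>E\<^esub> \<longleftrightarrow> p \<in> I"
proof -
  have "cls 0 = I" by (auto simp: mem_cls_iff)
  then show ?thesis using cls_eq_iff[of p 0] by (simp add: zero_E cong_def)
qed

lemma cls_mult: "p \<in> FA \<Longrightarrow> q \<in> FA \<Longrightarrow> cls p \<otimes>\<^bsub>E\<^esub> cls q = cls (p * q)"
  using cls.hom_mult[of p q] by (simp add: free_algebra_simps)

lemma cls_finsum:
  assumes "finite A" "\<And>i. i \<in> A \<Longrightarrow> g i \<in> FA"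
  shows "(\<Oplus>\<^bsub>E\<^esub>i\<in>A. cls (g i)) = cls (\<Sum>i\<in>A. g i)"
  using assms
proof (induction A rule: finite_induct)
  case empty
  then show ?case using cls.hom_zero by (simp add: free_algebra_simps)
next
  case (insert i A)
  have "(\<Sum>i\<in>A. g i) \<in> FA"
    using insert by (intro free.subspace_sum subspace_free_algebra) auto
  then show ?case
    using insert cls.hom_add[of "g i" "\<Sum>i\<in>A. g i"]
    by (subst cls.S.finsum_insert) (auto simp: free_algebra_simps(3))
qed

text \<open>From here on, decomposable elements are handled as classes of single words.\<close>

lemma wedge_eq_cls: "set xs \<subseteq> S \<Longrightarrow> wedge sc S xs = cls (mon xs 1)"
proof (induction xs)
  case Nil
  then show ?case using cls.hom_one by (simp add: wedge_def free_algebra_simps mon_Nil_one)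
next
  case (Cons x xs)
  then have "wedge sc S (x # xs) = cls (mon [x] 1) \<otimes>\<^bsub>E\<^esub> cls (mon xs 1)"
    by (simp add: wedge_def ext_vec_def)
  also have "\<dots> = cls (mon [x] 1 * mon xs 1)"
    using Cons.prems by (intro cls_mult mon_in_free_algebra) auto
  finally show ?case by (simp add: mon_mult)
qed

lemma ext_smult_cls: "p \<in> FA \<Longrightarrow> ext_smult sc S c (cls p) = cls (smul c p)"
  unfolding ext_smult_def by (intro cls_mult mon_in_free_algebra) auto

end

section \<open>The pairing of linear forms with vectors\<close>

text \<open>The cofactors along a row do not see that row, so the determinant is a fixed linear combination of
  the values of the form in that row. Linearity in that form, and the vanishing for a zero row, can be
  read off; the same works for columns.\<close>

lemma pairing_det_row_expansion:
  "\<exists>cof. \<forall>h. pairing_det (a @ h # b) ws = (\<Sum>j<length a + Suc (length b). h (ws ! j) * cof j)"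
proof -
  define n where "n = length a + Suc (length b)"
  define M where "M h = mat n n (\<lambda>(i, j). ((a @ h # b) ! i) (ws ! j))" for h
  have cof: "cofactor (M h) (length a) j = cofactor (M 0) (length a) j" for h j
    unfolding cofactor_def mat_delete_def M_def n_def
    by (intro arg_cong2[where f = "(*)"] refl arg_cong[where f = det] eq_matI)
      (auto simp: nth_append nth_Cons' not_less)
  have "pairing_det (a @ h # b) ws = (\<Sum>j<n. h (ws ! j) * cofactor (M 0) (length a) j)" for h
  proof -
    have "pairing_det (a @ h # b) ws = det (M h)"
      by (simp add: pairing_det_def M_def n_def)
    also have "\<dots> = (\<Sum>j<n. M h $$ (length a, j) * cofactor (M h) (length a) j)"
      by (rule laplace_expansion_row) (simp_all add: M_def n_def)
    also have "\<dots> = (\<Sum>j<n. h (ws ! j) * cofactor (M 0) (length a) j)"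
      by (intro sum.cong refl arg_cong2[where f = "(*)"] cof) (simp add: M_def n_def)
    finally show ?thesis .
  qed
  then show ?thesis
    by (intro exI[of _ "\<lambda>j. cofactor (M 0) (length a) j"] allI) (simp add: n_def)
qed

lemma pairing_det_column_expansion:
  assumes "length hs = length a + Suc (length b)"
  shows "\<exists>cof. \<forall>x. pairing_det hs (a @ x # b) = (\<Sum>i<length hs. (hs ! i) x * cof i)"
proof -
  define n where "n = length hs"
  define M where "M x = mat n n (\<lambda>(i, j). (hs ! i) ((a @ x # b) ! j))" for x
  have cof: "cofactor (M x) i (length a) = cofactor (M undefined) i (length a)" for x i
    unfolding cofactor_def mat_delete_def M_def n_def using assms
    by (intro arg_cong2[where f = "(*)"] refl arg_cong[where f = det] eq_matI)
      (auto simp: nth_append nth_Cons' not_less)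
  have "pairing_det hs (a @ x # b) = (\<Sum>i<n. (hs ! i) x * cofactor (M undefined) i (length a))" for x
  proof -
    have "pairing_det hs (a @ x # b) = det (M x)"
      by (simp add: pairing_det_def M_def n_def)
    also have "\<dots> = (\<Sum>i<n. M x $$ (i, length a) * cofactor (M x) i (length a))"
      by (rule laplace_expansion_column) (simp_all add: M_def n_def assms)
    also have "\<dots> = (\<Sum>i<n. (hs ! i) x * cofactor (M undefined) i (length a))"
      by (intro sum.cong refl arg_cong2[where f = "(*)"] cof) (simp add: M_def n_def assms)
    finally show ?thesis .
  qed
  then show ?thesis
    by (intro exI[of _ "\<lambda>i. cofactor (M undefined) i (length a)"] allI) (simp add: n_def)
qed

lemma pairing_det_row_add:
  "pairing_det (a @ (f + g) # b) ws = pairing_det (a @ f # b) ws + pairing_det (a @ g # b) ws"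
  using pairing_det_row_expansion[of a b ws] by (auto simp: distrib_right sum.distrib)

lemma pairing_det_row_scale:
  "pairing_det (a @ dual_scale c f # b) ws = c * pairing_det (a @ f # b) ws"
  using pairing_det_row_expansion[of a b ws]
  by (auto simp: dual_scale_def sum_distrib_left distrib_left mult.assoc)

lemma pairing_det_repeated_row: "pairing_det (a @ f # f # b) ws = 0"
  unfolding pairing_det_def
  by (rule det_identical_rows[of _ _ "length a" "Suc (length a)"])
    (auto simp: row_def nth_append)

lemma pairing_det_vanishing_row:
  assumes "h \<in> set hs" "\<forall>x\<in>set ws. h x = 0" "length ws = length hs"
  shows "pairing_det hs ws = 0"
proof -
  from assms(1) obtain a b where hs: "hs = a @ h # b" by (meson split_list)
  show ?thesis
    using pairing_det_row_expansion[of a b ws] assms(2,3) by (auto simp: hs)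
qed

lemma pairing_det_repeated_column:
  assumes "length hs = length a + Suc (Suc (length b))"
  shows "pairing_det hs (a @ x # x # b) = 0"
  unfolding pairing_det_def
  by (rule det_identical_columns[of _ _ "length a" "Suc (length a)"])
    (use assms in \<open>auto simp: col_def nth_append\<close>)

lemma pairing_det_first_row:
  assumes "length xs = Suc (length hs)"
  shows "pairing_det (h # hs) xs
    = (\<Sum>j<length xs. h (xs ! j) * (- 1) ^ j * pairing_det hs (take j xs @ drop (Suc j) xs))"
proof -
  define n where "n = length xs"
  define M where "M = mat n n (\<lambda>(i, j). ((h # hs) ! i) (xs ! j))"
  have "pairing_det (h # hs) xs = det M" by (simp add: pairing_det_def M_def n_def assms)
  also have "\<dots> = (\<Sum>j<n. M $$ (0, j) * cofactor M 0 j)"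
    by (rule laplace_expansion_row) (simp_all add: M_def n_def assms)
  also have "\<dots> = (\<Sum>j<n. h (xs ! j) * (- 1) ^ j * pairing_det hs (take j xs @ drop (Suc j) xs))"
  proof (rule sum.cong[OF refl])
    fix j assume j: "j \<in> {..<n}"
    have "mat_delete M 0 j
        = mat (length hs) (length hs) (\<lambda>(i, k). (hs ! i) ((take j xs @ drop (Suc j) xs) ! k))"
      using j assms by (intro eq_matI) (auto simp: mat_delete_def M_def n_def nth_append min_def)
    then show "M $$ (0, j) * cofactor M 0 j
        = h (xs ! j) * (- 1) ^ j * pairing_det hs (take j xs @ drop (Suc j) xs)"
      using j by (simp add: M_def cofactor_def pairing_det_def)
  qed
  finally show ?thesis by (simp add: n_def)
qed

text \<open>Evaluation at vectors turns the vectors into linear forms on the dual space.\<close>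

lemma pairing_det_transpose:
  assumes "length hs = length ws"
  shows "pairing_det (map (\<lambda>b f. f b) ws) hs = pairing_det hs ws"
proof -
  let ?M = "mat (length hs) (length hs) (\<lambda>(i, j). (hs ! i) (ws ! j))"
  have "transpose_mat ?M = mat (length ws) (length ws) (\<lambda>(i, j). (map (\<lambda>b f. f b) ws ! i) (hs ! j))"
    using assms by (intro eq_matI) auto
  then show ?thesis
    using det_transpose[of ?M "length hs"] by (simp add: pairing_det_def)
qed

section \<open>Expansion of a word in a spanning family\<close>

context exterior
begin

text \<open>The factor \<open>n!\<close> counts the orders in which the letters of a word without repetition occur among all
  words. The proof is by induction on \<open>n\<close>: expand each determinant along its first row. Summing over the
  first letter of the word recombines the \<open>j\<close>-th vector, by linearity in one place; summing over the
  rest gives \<open>(n - 1)!\<close> times \<open>xs\<close> without that vector, by the induction hypothesis. Moving the vector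
  back to its place cancels the sign \<open>(- 1) ^ j\<close>, so each of the \<open>n\<close> values of \<open>j\<close> contributes the same.\<close>

lemma mon_expansion_cong:
  assumes B: "finite B" and e: "\<And>b. b \<in> B \<Longrightarrow> e b \<in> S"
    and expand: "\<And>x. x \<in> S \<Longrightarrow> x = (\<Sum>b\<in>B. sc (\<phi> b x) (e b))"
    and xs: "xs \<in> lists S" "length xs = n"
  shows "cong (\<Sum>w | set w \<subseteq> B \<and> length w = n. mon (map e w) (pairing_det (map \<phi> w) xs))
    (mon xs (of_nat (fact n)))"
  using xs
proof (induction n arbitrary: xs)
  case 0
  then have "{w. set w \<subseteq> B \<and> length w = 0} = {[]}" by auto
  with 0 show ?case by (simp add: pairing_det_def)
next
  case (Suc n)
  (* the word without its j-th letter *)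
  define del where "del j = take j xs @ drop (Suc j) xs" for j
  let ?Ws = "{w. set w \<subseteq> B \<and> length w = n}"
  have del: "del j \<in> lists S" "length (del j) = n" "xs ! j \<in> S" if "j < Suc n" for j
    using that Suc.prems by (auto simp: del_def dest: in_set_takeD in_set_dropD)
  have "(\<Sum>w | set w \<subseteq> B \<and> length w = Suc n. mon (map e w) (pairing_det (map \<phi> w) xs))
    = (\<Sum>(w, b)\<in>?Ws \<times> B. mon (e b # map e w) (pairing_det (\<phi> b # map \<phi> w) xs))"
    unfolding lists_length_Suc_eq by (subst sum.reindex) (auto simp: inj_on_def case_prod_beta)
  also have "\<dots> = (\<Sum>(w, b)\<in>?Ws \<times> B. \<Sum>j<Suc n.
      smul ((- 1) ^ j) (mon [e b] (\<phi> b (xs ! j)) * mon (map e w) (pairing_det (map \<phi> w) (del j))))"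
    using Suc.prems
    by (intro sum.cong refl)
      (auto simp: pairing_det_first_row mon_sum mon_mult del_def mult_ac simp del: sum.lessThan_Suc)
  also have "\<dots> = (\<Sum>j<Suc n. \<Sum>(w, b)\<in>?Ws \<times> B.
      smul ((- 1) ^ j) (mon [e b] (\<phi> b (xs ! j)) * mon (map e w) (pairing_det (map \<phi> w) (del j))))"
    by (simp only: case_prod_unfold) (rule sum.swap)
  also have "\<dots> = (\<Sum>j<Suc n. smul ((- 1) ^ j) ((\<Sum>b\<in>B. mon [e b] (\<phi> b (xs ! j)))
      * (\<Sum>w\<in>?Ws. mon (map e w) (pairing_det (map \<phi> w) (del j)))))"
    by (simp only: sum.cartesian_product[symmetric] sum_distrib_left sum_distrib_right)
  also have "cong \<dots> (\<Sum>j<Suc n. smul ((- 1) ^ j) (mon [xs ! j] 1 * mon (del j) (of_nat (fact n))))"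
  proof (intro cong_sum cong_smul)
    fix j assume "j \<in> {..<Suc n}"
    then have j: "j < Suc n" by simp
    have "cong (\<Sum>b\<in>B. mon [e b] (\<phi> b (xs ! j))) (mon [xs ! j] 1)"
    proof (rule cong_sym)
      have "cong (mon [\<Sum>b\<in>B. sc (\<phi> b (xs ! j)) (e b)] 1) (\<Sum>b\<in>B. mon [e b] (\<phi> b (xs ! j)))"
        using mon_sum_cong[OF B, of e "\<lambda>b. \<phi> b (xs ! j)"] e by blast
      then show "cong (mon [xs ! j] 1) (\<Sum>b\<in>B. mon [e b] (\<phi> b (xs ! j)))"
        unfolding expand[OF del(3)[OF j], symmetric] .
    qed
    then have "cong ((\<Sum>b\<in>B. mon [e b] (\<phi> b (xs ! j)))
        * (\<Sum>w\<in>?Ws. mon (map e w) (pairing_det (map \<phi> w) (del j))))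
      (mon [xs ! j] 1 * (\<Sum>w\<in>?Ws. mon (map e w) (pairing_det (map \<phi> w) (del j))))"
      by (rule cong_mult_right)
        (intro free.subspace_sum[OF subspace_free_algebra] mon_in_free_algebra, auto intro!: e)
    also have "cong \<dots> (mon [xs ! j] 1 * mon (del j) (of_nat (fact n)))"
      by (intro cong_mult_left Suc.IH mon_in_free_algebra) (use del[OF j] in auto)
    finally show "cong ((\<Sum>b\<in>B. mon [e b] (\<phi> b (xs ! j)))
        * (\<Sum>w\<in>?Ws. mon (map e w) (pairing_det (map \<phi> w) (del j))))
      (mon [xs ! j] 1 * mon (del j) (of_nat (fact n)))" .
  qed
  also have "\<dots> = (\<Sum>j<Suc n. smul (of_nat (fact n)) (mon (xs ! j # del j) ((- 1) ^ j)))"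
    by (simp add: mon_mult mult.commute)
  also have "cong \<dots> (\<Sum>j<Suc n. smul (of_nat (fact n)) (mon xs 1))"
  proof (intro cong_sum cong_smul)
    fix j assume "j \<in> {..<Suc n}"
    then have j: "j < length xs" using Suc.prems by simp
    have "cong (mon (xs ! j # take j xs @ drop (Suc j) xs) ((- 1) ^ length (take j xs)))
        (mon (take j xs @ xs ! j # drop (Suc j) xs) 1)"
      using j Suc.prems
      by (intro mon_move_front_cong) (auto dest: in_set_takeD in_set_dropD)
    then show "cong (mon (xs ! j # del j) ((- 1) ^ j)) (mon xs 1)"
      using j id_take_nth_drop[OF j] by (simp add: del_def min_def)
  qed
  also have "\<dots> = mon xs (of_nat (fact (Suc n)))"
  proof -
    have "(\<Sum>j<Suc n. of_nat (fact n)) = (of_nat (fact (Suc n)) :: 'k)"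
      by (simp add: algebra_simps)
    then show ?thesis
      by (simp only: mon_mult append_Nil mult_1_right flip: mon_sum)
  qed
  finally show ?case .
qed

end

section \<open>The sign of a shuffle\<close>

text \<open>An adjacent transposition is increasing on a set that does not contain both of its points.\<close>

lemma sorted_list_of_set_transpose:
  fixes A :: "nat set"
  assumes A: "finite A" and i: "\<not> (i \<in> A \<and> Suc i \<in> A)"
  shows "sorted_list_of_set (transpose i (Suc i) ` A)
    = map (transpose i (Suc i)) (sorted_list_of_set A)"
proof -
  let ?t = "transpose i (Suc i)"
  have "sorted_wrt (\<lambda>x y. ?t x < ?t y) (sorted_list_of_set A)"
  proof (rule sorted_wrt_mono_rel[of _ "(<)"])
    show "?t x < ?t y"
      if "x \<in> set (sorted_list_of_set A)" "y \<in> set (sorted_list_of_set A)" "x < y" for x y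
      using that A i by (auto simp: transpose_def)
    show "sorted_wrt (<) (sorted_list_of_set A)" by simp
  qed
  then have "sorted_wrt (<) (map ?t (sorted_list_of_set A))" by (simp add: sorted_wrt_map)
  then have "sorted_list_of_set (set (map ?t (sorted_list_of_set A)))
      = map ?t (sorted_list_of_set A)"
    by (intro sorted_list_of_set.idem_if_sorted_distinct)
      (simp_all add: strict_sorted_iff)
  then show ?thesis using A by simp
qed

lemma permutes_nth:
  assumes "distinct l" "set l = {..<d}"
  shows "(\<lambda>i. if i < d then l ! i else i) permutes {..<d}"
proof (rule bij_imp_permutes)
  have "length l = d" using distinct_card[OF assms(1)] assms(2) by simp
  then have "bij_betw ((!) l) {..<d} {..<d}" using assms by (intro bij_betw_nth) auto
  then show "bij_betw (\<lambda>i. if i < d then l ! i else i) {..<d} {..<d}"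
    by (rule iffD1[OF bij_betw_cong, rotated]) auto
qed simp

text \<open>When \<open>R\<close> separates \<open>i\<close> from \<open>Suc i\<close>, neither \<open>R\<close> nor its complement contains both, so the transposition
  commutes with the sorting of the two blocks, and the shuffle is composed with one transposition.\<close>

lemma shuffle_sign_transpose:
  assumes R: "R \<subseteq> {..<d}" and i: "Suc i < d" and one: "i \<in> R \<longleftrightarrow> Suc i \<notin> R"
  shows "shuffle_sign d (transpose i (Suc i) ` R) = - shuffle_sign d R"
proof -
  let ?t = "transpose i (Suc i)"
  let ?l = "sorted_list_of_set R @ sorted_list_of_set ({..<d} - R)"
  let ?p = "\<lambda>k. if k < d then ?l ! k else k"
  have fin: "finite R" using R finite_subset by blast
  have set_l: "set ?l = {..<d}" and dist: "distinct ?l" using R fin by auto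
  then have len: "length ?l = d" using distinct_card[OF dist] by simp
  have "?t ` {..<d} = {..<d}"
    using i by (intro permutes_image permutes_swap_id) auto
  then have "{..<d} - ?t ` R = ?t ` ({..<d} - R)"
    by (metis image_set_diff inj_transpose)
  then have "sorted_list_of_set (?t ` R) @ sorted_list_of_set ({..<d} - ?t ` R) = map ?t ?l"
    using one fin i by (simp add: sorted_list_of_set_transpose)
  then have "shuffle_sign d (?t ` R) = sign (\<lambda>k. if k < d then map ?t ?l ! k else k)"
    unfolding shuffle_sign_def by (simp only:)
  also have "(\<lambda>k. if k < d then map ?t ?l ! k else k) = ?t \<circ> ?p"
    using i len by (auto simp: fun_eq_iff transpose_def simp del: map_append)
  also have "sign (?t \<circ> ?p) = sign ?t * sign ?p"
    using permutes_nth[OF dist set_l] permutation_permutes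
    by (intro sign_compose permutation_swap_id) blast
  finally show ?thesis by (simp add: shuffle_sign_def sign_swap_id)
qed

lemma shuffle_sign_full: "shuffle_sign d {..<d} = 1"
proof -
  have "(\<lambda>i. if i < d then (sorted_list_of_set {..<d} @ sorted_list_of_set ({..<d} - {..<d})) ! i
      else i) = id"
    by (auto simp: lessThan_atLeast0)
  then show ?thesis unfolding shuffle_sign_def by (simp only: sign_id)
qed

section \<open>The skew-apolarity action is well defined\<close>

lemma skew_action_free_linear_left:
  "skew_action_free p q = linear_ext (\<lambda>hs. linear_ext (skew_action_word hs) q) p"
  unfolding skew_action_free_def linear_ext_def
  by (simp add: sum_distrib_left mon_mult flip: mult.assoc)

lemma skew_action_free_linear_right:
  "skew_action_free p q = linear_ext (\<lambda>vs. linear_ext (\<lambda>hs. skew_action_word hs vs) p) q"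
  unfolding skew_action_free_def linear_ext_def
  by (subst sum.swap) (simp add: sum_distrib_left mon_mult mult.commute flip: mult.assoc)

lemma nths_cong:
  assumes "\<And>k. k < length xs \<Longrightarrow> k \<in> A \<longleftrightarrow> k \<in> B"
  shows "nths xs A = nths xs B"
  unfolding nths_def using assms
  by (intro arg_cong[where f = "map fst"] filter_cong) (auto simp: set_zip)

lemma nths_middle:
  "nths (a @ z # b) R
    = nths a R @ (if length a \<in> R then [z] else []) @ nths b {j. Suc (j + length a) \<in> R}"
  by (simp add: nths_append nths_Cons)

lemma length_nths_subset: "R \<subseteq> {..<length xs} \<Longrightarrow> length (nths xs R) = card R"
  unfolding length_nths by (rule arg_cong[where f = card]) auto

lemma skew_action_word_row_add:
  "skew_action_word (a @ (f + g) # b) vs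
    = skew_action_word (a @ f # b) vs + skew_action_word (a @ g # b) vs"
  by (simp add: skew_action_word_def pairing_det_row_add distrib_left single_add sum.distrib)

lemma skew_action_word_row_scale:
  "skew_action_word (a @ dual_scale c f # b) vs = smul c (skew_action_word (a @ f # b) vs)"
  by (simp add: skew_action_word_def pairing_det_row_scale sum_distrib_left mon_mult mult.left_commute)

lemma skew_action_word_repeated_row: "skew_action_word (a @ f # f # b) vs = 0"
  by (simp add: skew_action_word_def pairing_det_repeated_row)

text \<open>Every minor that occurs has a zero row.\<close>

lemma skew_action_word_vanishing:
  assumes "h \<in> set hs" "\<forall>x\<in>set vs. h x = 0"
  shows "skew_action_word hs vs = 0"
proof -
  have "pairing_det hs (nths vs R) = 0" if "R \<subseteq> {..<length vs}" "card R = length hs" for R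
    using that assms set_nths_subset[of vs R]
    by (intro pairing_det_vanishing_row[OF assms(1)]) (auto simp: length_nths_subset)
  then show ?thesis by (simp add: skew_action_word_def)
qed

text \<open>In top degree only the full set of positions contributes, and its shuffle is the identity.\<close>

lemma skew_action_word_top:
  assumes "length hs = length vs"
  shows "skew_action_word hs vs = mon [] (pairing_det hs vs)"
proof -
  have "{R. R \<subseteq> {..<length vs} \<and> card R = length hs} = {{..<length vs}}"
    using assms card_subset_eq[of "{..<length vs}"] by auto
  then show ?thesis
    by (simp add: skew_action_word_def shuffle_sign_full nths_all)
qed

locale skew_apolarity = vector_space scale
  for scale :: "'k::field \<Rightarrow> 'v::ab_group_add \<Rightarrow> 'v"
begin

abbreviation D where "D \<equiv> dual_space scale"

lemma dual_add: "h \<in> D \<Longrightarrow> h (x + y) = h x + h y"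
  and dual_scale: "h \<in> D \<Longrightarrow> h (scale c x) = c * h x"
  by (simp_all add: dual_space_def Vector_Spaces.linear_iff)

lemma in_dualI:
  assumes "\<And>x y. h (x + y) = h x + h y" "\<And>c x. h (scale c x) = c * h x"
  shows "h \<in> D"
proof -
  have "vector_space ((*) :: 'k \<Rightarrow> 'k \<Rightarrow> 'k)" by standard (simp_all add: algebra_simps)
  then show ?thesis
    using assms vector_space_axioms by (simp add: dual_space_def Vector_Spaces.linear_iff)
qed

sublocale V: exterior scale UNIV by standard auto

sublocale D: exterior dual_scale D
  by standard (auto intro!: in_dualI simp: dual_add dual_scale dual_scale_def algebra_simps)

text \<open>Each summand is treated separately: the varying vector is a column of the minor if its position is
  selected, and otherwise a letter of the remaining word. In the first case the summand is linear on the
  nose, in the second only modulo the exterior ideal.\<close>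

lemma skew_action_word_column_linear:
  assumes hs: "hs \<in> lists D"
  shows "skew_action_word hs (a @ (x + y) # b) - skew_action_word hs (a @ x # b)
      - skew_action_word hs (a @ y # b) \<in> V.I" (is ?add)
    and "skew_action_word hs (a @ scale c x # b) - smul c (skew_action_word hs (a @ x # b)) \<in> V.I"
      (is ?scale)
proof -
  define d where "d = length a + Suc (length b)"
  define Rs where "Rs = {R. R \<subseteq> {..<d} \<and> card R = length hs}"
  define T where "T z R = mon (nths (a @ z # b) ({..<d} - R))
      (of_int (shuffle_sign d R) * pairing_det hs (nths (a @ z # b) R))" for z R
  have action: "skew_action_word hs (a @ z # b) = (\<Sum>R\<in>Rs. T z R)" for z
    by (simp add: skew_action_word_def Rs_def T_def d_def)
  have T: "T (x + y) R - T x R - T y R \<in> V.I \<and> T (scale c x) R - smul c (T x R) \<in> V.I"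
    if R: "R \<in> Rs" for R
  proof (cases "length a \<in> R")
    case True
    define A B where "A = nths a R" and "B = nths b {j. Suc (j + length a) \<in> R}"
    have C: "nths (a @ z # b) ({..<d} - R) = nths a ({..<d} - R)
        @ nths b {j. Suc (j + length a) \<in> {..<d} - R}" for z
      using True by (simp add: nths_middle)
    have AB: "nths (a @ z # b) R = A @ z # B" for z
      using True by (simp add: nths_middle A_def B_def)
    have "length hs = length A + Suc (length B)"
      using R length_nths_subset[of R "a @ x # b"] AB[of x] by (simp add: Rs_def d_def)
    then obtain cof where cof: "\<And>z. pairing_det hs (A @ z # B) = (\<Sum>i<length hs. (hs ! i) z * cof i)"
      using pairing_det_column_expansion by blast
    have h: "hs ! i \<in> D" if "i < length hs" for i using hs that by auto
    have "pairing_det hs (A @ (x + y) # B) = pairing_det hs (A @ x # B) + pairing_det hs (A @ y # B)"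
      "pairing_det hs (A @ scale c x # B) = c * pairing_det hs (A @ x # B)"
      by (simp_all add: cof dual_add[OF h] dual_scale[OF h] distrib_right sum.distrib
          sum_distrib_left mult.assoc)
    then show ?thesis
      by (simp add: T_def AB C distrib_left single_add mon_mult mult.left_commute
          free.subspace_0[OF V.subspace_I])
  next
    case False
    define A B \<kappa> where "A = nths a ({..<d} - R)"
      and "B = nths b {j. Suc (j + length a) \<in> {..<d} - R}"
      and "\<kappa> = of_int (shuffle_sign d R) * pairing_det hs (nths (a @ x # b) R)"
    have "T z R = mon A 1 * mon [z] 1 * mon B \<kappa>" for z
      using False by (simp add: T_def nths_middle A_def B_def \<kappa>_def mon_mult d_def)
    moreover have "mon A 1 * (mon [x + y] 1 - mon [x] 1 - mon [y] 1) * mon B \<kappa> \<in> V.I"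
      "mon A 1 * (mon [scale c x] 1 - mon [x] c) * mon B \<kappa> \<in> V.I"
      using V.mon_add_cong[of x y] V.mon_scale_cong[of x c]
      by (auto simp: V.cong_def diff_diff_eq
          intro!: V.mult_I_right[OF V.mult_I_left] mon_in_free_algebra)
    ultimately show ?thesis
      by (simp add: left_diff_distrib right_diff_distrib mon_mult)
  qed
  have "(\<Sum>R\<in>Rs. T (x + y) R - T x R - T y R) \<in> V.I" "(\<Sum>R\<in>Rs. T (scale c x) R - smul c (T x R)) \<in> V.I"
    using T by (auto intro!: V.in_I_sum)
  then show ?add ?scale by (simp_all add: action sum_subtractf sum_distrib_left)
qed

text \<open>If the two equal vectors are both selected, the minor has equal columns; if neither is, the remaining
  word contains a square. The other selections come in pairs, exchanged by the transposition of the two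
  positions: they have the same minor and the same remaining word, but opposite signs.\<close>

lemma skew_action_word_repeated_column: "skew_action_word hs (a @ x # x # b) \<in> V.I"
proof -
  define i where "i = length a"
  define d where "d = length a + Suc (Suc (length b))"
  define Rs where "Rs = {R. R \<subseteq> {..<d} \<and> card R = length hs}"
  let ?t = "transpose i (Suc i)"
  define T where "T R = mon (nths (a @ x # x # b) ({..<d} - R))
      (of_int (shuffle_sign d R) * pairing_det hs (nths (a @ x # x # b) R))" for R
  have finRs: "finite Rs" unfolding Rs_def by (rule finite_subset[of _ "Pow {..<d}"]) auto
  have nths2: "nths (a @ x # x # b) R = nths a R @ (if i \<in> R then [x] else [])
      @ (if Suc i \<in> R then [x] else []) @ nths b {j. Suc (Suc (j + i)) \<in> R}" for R
    by (simp add: nths_append nths_Cons i_def)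
  have t_iff: "k \<in> ?t ` R \<longleftrightarrow> ?t k \<in> R" for k R
    by (metis image_iff transpose_involutory)
  have nths_t: "nths (a @ x # x # b) (?t ` R) = nths (a @ x # x # b) R"
    if "i \<in> R \<longleftrightarrow> Suc i \<notin> R" for R
  proof -
    have "nths a (?t ` R) = nths a R"
      by (rule nths_cong, subst t_iff) (simp add: i_def)
    moreover have "{j. Suc (Suc (j + i)) \<in> ?t ` R} = {j. Suc (Suc (j + i)) \<in> R}"
      by (auto simp: t_iff)
    ultimately show ?thesis using that by (auto simp: nths2 t_iff)
  qed
  have t_d: "?t ` {..<d} = {..<d}"
    by (intro permutes_image permutes_swap_id) (auto simp: d_def i_def)
  have T_t: "T (?t ` R) = - T R" if R: "R \<in> Rs" "i \<in> R" "Suc i \<notin> R" for R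
  proof -
    have "{..<d} - ?t ` R = ?t ` ({..<d} - R)"
      using t_d by (metis image_set_diff inj_transpose)
    moreover have "nths (a @ x # x # b) (?t ` ({..<d} - R)) = nths (a @ x # x # b) ({..<d} - R)"
      using R by (intro nths_t) (auto simp: d_def i_def)
    moreover have "shuffle_sign d (?t ` R) = - shuffle_sign d R"
      using R by (intro shuffle_sign_transpose) (auto simp: Rs_def d_def i_def)
    ultimately show ?thesis
      using R by (simp add: T_def nths_t single_uminus)
  qed
  have ti: "i \<in> ?t ` R \<longleftrightarrow> Suc i \<in> R" "Suc i \<in> ?t ` R \<longleftrightarrow> i \<in> R" for R
    by (subst t_iff, simp)+
  have bij: "bij_betw ((`) ?t) {R \<in> Rs. i \<in> R \<and> Suc i \<notin> R} {R \<in> Rs. i \<notin> R \<and> Suc i \<in> R}"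
  proof (rule bij_betw_byWitness[of _ "(`) ?t"])
    have "?t ` R \<in> Rs" if "R \<in> Rs" for R
      using that t_d by (auto simp: Rs_def card_image inj_transpose inj_on_subset[OF inj_transpose])
    then show "(`) ?t ` {R \<in> Rs. i \<in> R \<and> Suc i \<notin> R} \<subseteq> {R \<in> Rs. i \<notin> R \<and> Suc i \<in> R}"
      "(`) ?t ` {R \<in> Rs. i \<notin> R \<and> Suc i \<in> R} \<subseteq> {R \<in> Rs. i \<in> R \<and> Suc i \<notin> R}"
      by (intro image_subsetI, simp only: mem_Collect_eq ti, blast)+
  qed (auto simp: image_comp)
  have "(\<Sum>R\<in>{R \<in> Rs. i \<notin> R \<and> Suc i \<in> R}. T R) = (\<Sum>R\<in>{R \<in> Rs. i \<in> R \<and> Suc i \<notin> R}. T (?t ` R))"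
    using sum.reindex_bij_betw[OF bij, of T] by simp
  also have "\<dots> = - (\<Sum>R\<in>{R \<in> Rs. i \<in> R \<and> Suc i \<notin> R}. T R)"
    by (simp add: T_t sum_negf)
  finally have one: "(\<Sum>R\<in>{R \<in> Rs. i \<in> R \<and> Suc i \<notin> R}. T R) + (\<Sum>R\<in>{R \<in> Rs. i \<notin> R \<and> Suc i \<in> R}. T R) = 0"
    by simp
  have both: "T R \<in> V.I" if R: "R \<in> Rs" "i \<in> R \<longleftrightarrow> Suc i \<in> R" for R
  proof (cases "i \<in> R")
    case True
    have "length hs = length (nths (a @ x # x # b) R)"
      using R length_nths_subset[of R "a @ x # x # b"] by (simp add: Rs_def d_def)
    then have "pairing_det hs (nths (a @ x # x # b) R) = 0"
      using True R by (simp add: nths2 pairing_det_repeated_column)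
    then show ?thesis by (simp add: T_def free.subspace_0[OF V.subspace_I])
  next
    case False
    define A B \<kappa> where "A = nths a ({..<d} - R)"
      and "B = nths b {j. Suc (Suc (j + i)) \<in> {..<d} - R}"
      and "\<kappa> = of_int (shuffle_sign d R) * pairing_det hs (nths (a @ x # x # b) R)"
    have "T R = mon A 1 * mon [x, x] 1 * mon B \<kappa>"
      using False R by (simp add: T_def nths2 A_def B_def \<kappa>_def mon_mult d_def i_def)
    then show ?thesis
      using V.mon_square_cong[of x]
      by (auto simp: V.cong_def intro!: V.mult_I_right[OF V.mult_I_left] mon_in_free_algebra)
  qed
  have "skew_action_word hs (a @ x # x # b) = (\<Sum>R\<in>Rs. T R)"
    by (simp add: skew_action_word_def Rs_def T_def d_def)
  also have "\<dots> = (\<Sum>R\<in>{R \<in> Rs. i \<in> R \<longleftrightarrow> Suc i \<in> R} \<union>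
      ({R \<in> Rs. i \<in> R \<and> Suc i \<notin> R} \<union> {R \<in> Rs. i \<notin> R \<and> Suc i \<in> R}). T R)"
    by (rule sum.cong) auto
  also have "\<dots> = (\<Sum>R\<in>{R \<in> Rs. i \<in> R \<longleftrightarrow> Suc i \<in> R}. T R)"
    using finRs one by (subst sum.union_disjoint; (subst sum.union_disjoint)?) auto
  finally show ?thesis using both by (auto intro!: V.in_I_sum)
qed

text \<open>On the side of the linear forms the action is alternating before passing to classes, because the
  forms enter only through the minors.\<close>

lemma linear_ext_action_dual_ideal:
  assumes "p \<in> D.I" shows "linear_ext (\<lambda>hs. skew_action_word hs vs) p = 0"
proof -
  have "linear_ext (\<lambda>hs. skew_action_word hs vs) p \<in> {0}"
    by (rule D.linear_ext_alternating[OF _ _ _ _ assms])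
      (auto simp: skew_action_word_row_add skew_action_word_row_scale skew_action_word_repeated_row)
  then show ?thesis by simp
qed

lemma skew_action_free_right_ideal:
  assumes p: "p \<in> D.FA" and q: "q \<in> V.I"
  shows "skew_action_free p q \<in> V.I"
  unfolding skew_action_free_linear_left
proof (rule linear_ext_in_subspace[OF V.subspace_I])
  fix hs assume "hs \<in> Poly_Mapping.keys p"
  then have "hs \<in> lists D" using p by (auto simp: free_algebra_simps)
  then show "linear_ext (skew_action_word hs) q \<in> V.I"
    by (intro V.linear_ext_alternating[OF V.subspace_I _ _ _ q] skew_action_word_column_linear
        skew_action_word_repeated_column)
qed

end

section \<open>Spans and separating functionals\<close>

context vector_space
begin

lemma span_image_sum:
  assumes "x \<in> span (g ` A)" "finite A"
  shows "\<exists>c. x = (\<Sum>k\<in>A. scale (c k) (g k))"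
  using assms(1)
proof (induction rule: span_induct_alt)
  case base
  show ?case by (rule exI[of _ "\<lambda>_. 0"]) simp
next
  case (step a y z)
  then obtain k c where k: "k \<in> A" "y = g k" and c: "z = (\<Sum>k\<in>A. scale (c k) (g k))" by blast
  have "(\<Sum>j\<in>A. scale (c j + (if j = k then a else 0)) (g j))
      = z + (\<Sum>j\<in>A. if j = k then scale a (g j) else 0)"
    unfolding c sum.distrib[symmetric] by (intro sum.cong) (auto simp: scale_left_distrib)
  also have "\<dots> = scale a y + z" using k assms(2) by simp
  finally show ?case by metis
qed

text \<open>Take the coordinate of \<open>q\<close> in a basis that consists of \<open>q\<close>, a basis of \<open>U\<close> and further vectors.\<close>

lemma separating_functional:
  assumes U: "subspace U" and q: "q \<notin> U"
  shows "\<exists>\<phi>. (\<forall>x y. \<phi> (x + y) = \<phi> x + \<phi> y) \<and> (\<forall>c x. \<phi> (scale c x) = c * \<phi> x)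
    \<and> (\<forall>x\<in>U. \<phi> x = 0) \<and> \<phi> q = 1"
proof -
  obtain A where A: "A \<subseteq> U" "independent A" "U \<subseteq> span A"
    using basis_exists[of U] by metis
  then have span_A: "span A = U" using span_minimal[OF A(1) U] by blast
  define B where "B = extend_basis (insert q A)"
  have ind: "independent (insert q A)" using A q span_A by (intro independent_insertI) auto
  have B: "independent B" "span B = UNIV" "insert q A \<subseteq> B"
    using ind independent_extend_basis span_extend_basis extend_basis_superset
    unfolding B_def by auto
  have "representation B x q = 0" if "x \<in> U" for x
  proof -
    have "representation B x = representation A x"
      using that B span_A by (intro representation_extend) auto
    moreover have "q \<notin> A" using q A by auto
    ultimately show ?thesis using representation_ne_zero[of A x q] by metis
  qed
  moreover have "representation B q q = 1" using representation_basis[OF B(1), of q] B(3) by simp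
  ultimately show ?thesis
    using B by (intro exI[of _ "\<lambda>x. representation B x q"])
      (simp add: representation_add representation_scale)
qed

end

section \<open>The ideal of forms vanishing on a subspace\<close>

context skew_apolarity
begin

lemma ext_vec_forms_in_carrier:
  "ext_vec dual_scale D ` {f \<in> D. \<forall>x\<in>W. f x = 0} \<subseteq> carrier D.E"
  by (auto simp: D.carrier_E ext_vec_def intro!: mon_in_free_algebra)

lemma ideal_perp: "ideal (subspace_perp scale W) D.E"
  unfolding subspace_perp_def by (rule D.cls.S.genideal_ideal[OF ext_vec_forms_in_carrier])

text \<open>The elements of the free algebra all of whose two-sided multiples act as zero on \<open>vs\<close> form an ideal;
  it contains the forms that vanish on \<open>W\<close>, hence its image contains the ideal that they generate.
  Representatives of one class differ by the exterior ideal, which acts as zero.\<close>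

lemma perp_annihilates_word:
  assumes h: "h \<in> subspace_perp scale W" and p: "p \<in> h" and vs: "set vs \<subseteq> W"
  shows "linear_ext (\<lambda>hs. skew_action_word hs vs) p = 0"
proof -
  let ?f = "\<lambda>hs. skew_action_word hs vs"
  define J where "J = {q \<in> D.FA. \<forall>a\<in>D.FA. \<forall>b\<in>D.FA. linear_ext ?f (a * q * b) \<in> {0}}"
  have J: "ideal J (free_algebra D)"
    unfolding J_def by (rule D.ideal_linear_ext) simp
  then have "ideal (D.cls ` J) D.E"
    using ring.ring_ideal_imp_quot_ideal[OF ring_free_algebra D.ideal_exterior]
    by (simp add: exterior_algebra_def ext_class_def[abs_def])
  moreover have "ext_vec dual_scale D ` {f \<in> D. \<forall>x\<in>W. f x = 0} \<subseteq> D.cls ` J"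
  proof (intro image_subsetI)
    fix f assume f: "f \<in> {f \<in> D. \<forall>x\<in>W. f x = 0}"
    have "linear_ext ?f (a * mon [f] 1 * b) \<in> {0}" if "a \<in> D.FA" "b \<in> D.FA" for a b
    proof (rule linear_ext_two_sided[OF _ _ that])
      fix u w
      have "skew_action_word (u @ f # w) vs = 0"
        using f vs by (intro skew_action_word_vanishing[of f]) auto
      then show "linear_ext ?f (mon u 1 * mon [f] 1 * mon w 1) \<in> {0}"
        by (simp add: mon_mult linear_ext_mon)
    qed simp
    then have "mon [f] 1 \<in> J"
      using f by (auto simp: J_def intro!: mon_in_free_algebra)
    then show "ext_vec dual_scale D f \<in> D.cls ` J" by (auto simp: ext_vec_def)
  qed
  ultimately have "subspace_perp scale W \<subseteq> D.cls ` J"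
    unfolding subspace_perp_def by (rule D.cls.S.genideal_minimal)
  then obtain q where q: "q \<in> J" "p - q \<in> D.I" using h p by (auto simp: D.mem_cls_iff)
  have "linear_ext ?f (1 * q * 1) \<in> {0}" using q(1) D.one_in_FA unfolding J_def by blast
  moreover have "linear_ext ?f (p - q) = 0" by (rule linear_ext_action_dual_ideal[OF q(2)])
  ultimately show ?thesis by (simp add: linear_ext_diff)
qed

lemma vanishing_word_in_perp:
  assumes "hs \<in> lists D" "f \<in> set hs" "\<forall>x\<in>W. f x = 0"
  shows "D.cls (mon hs c) \<in> subspace_perp scale W"
proof -
  interpret P: ideal "subspace_perp scale W" D.E by (rule ideal_perp)
  obtain a b where hs: "hs = a @ f # b" using assms(2) by (meson split_list)
  then have ab: "mon a c \<in> D.FA" "mon [f] 1 \<in> D.FA" "mon b 1 \<in> D.FA" "mon (a @ [f]) c \<in> D.FA"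
    using assms(1) by (auto intro!: mon_in_free_algebra)
  have "D.cls (mon [f] 1) \<in> ext_vec dual_scale D ` {f \<in> D. \<forall>x\<in>W. f x = 0}"
    using assms hs by (auto simp: ext_vec_def)
  then have "D.cls (mon [f] 1) \<in> subspace_perp scale W"
    unfolding subspace_perp_def
    using D.cls.S.genideal_self[OF ext_vec_forms_in_carrier] by blast
  then have "D.cls (mon a c) \<otimes>\<^bsub>D.E\<^esub> D.cls (mon [f] 1) \<otimes>\<^bsub>D.E\<^esub> D.cls (mon b 1) \<in> subspace_perp scale W"
    using ab by (intro P.I_r_closed P.I_l_closed) (auto simp: D.carrier_E)
  then show ?thesis
    using ab by (simp add: D.cls_mult mon_mult hs)
qed

lemma subspace_perp_representatives:
  "free.subspace {p \<in> D.FA. D.cls p \<in> subspace_perp scale W}" (is "free.subspace ?K")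
proof -
  interpret P: ideal "subspace_perp scale W" D.E by (rule ideal_perp)
  show ?thesis
  proof (rule free.subspaceI)
    have "D.cls 0 = \<zero>\<^bsub>D.E\<^esub>"
      by (simp add: D.cls_eq_zero_iff free.subspace_0[OF D.subspace_I])
    then show "0 \<in> ?K"
      using additive_subgroup.zero_closed[OF P.additive_subgroup_axioms]
      by (simp add: free_algebra_simps)
    show "p + q \<in> ?K" if "p \<in> ?K" "q \<in> ?K" for p q
      using that additive_subgroup.a_closed[OF P.additive_subgroup_axioms, of "D.cls p" "D.cls q"]
        D.cls.hom_add[of p q] free.subspace_add[OF subspace_free_algebra, of p D q]
      by (simp add: free_algebra_simps(3))
    show "smul c p \<in> ?K" if "p \<in> ?K" for c p
    proof -
      have c: "mon [] c \<in> D.FA" by (rule mon_in_free_algebra) simp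
      then have "D.cls (mon [] c) \<otimes>\<^bsub>D.E\<^esub> D.cls p \<in> subspace_perp scale W"
        using that by (intro P.I_l_closed) (auto simp: D.carrier_E)
      then show ?thesis using that c by (simp add: D.cls_mult D.mult_in_FA)
    qed
  qed
qed

text \<open>If \<open>C\<close> expresses the vectors of \<open>w\<close> through those of \<open>vs\<close>, then the matrix of values on \<open>w\<close> is the matrix
  of values on \<open>vs\<close> times \<open>C\<close>. The factor is the determinant of \<open>C\<close>, which is independent of the forms.\<close>

lemma pairing_det_span:
  assumes vs: "length vs = d" and w: "length w = d" "set w \<subseteq> span (set vs)"
  shows "\<exists>c. \<forall>hs\<in>lists D. length hs = d \<longrightarrow> pairing_det hs w = pairing_det hs vs * c"
proof -
  have "\<exists>c. w ! j = (\<Sum>k<d. scale (c k) (vs ! k))" if "j < d" for j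
  proof (rule span_image_sum)
    have "set vs = (!) vs ` {..<d}" using vs by (auto simp: set_conv_nth)
    then show "w ! j \<in> span ((!) vs ` {..<d})" using that w by auto
  qed simp
  then obtain c where c: "\<And>j. j < d \<Longrightarrow> w ! j = (\<Sum>k<d. scale (c j k) (vs ! k))" by metis
  define C where "C = mat d d (\<lambda>(k, j). c j k)"
  have "pairing_det hs w = pairing_det hs vs * det C" if hs: "hs \<in> lists D" "length hs = d" for hs
  proof -
    let ?M = "\<lambda>ws. mat d d (\<lambda>(i, j). (hs ! i) (ws ! j))"
    have "?M w = ?M vs * C"
    proof (rule eq_matI)
      fix i j assume "i < dim_row (?M vs * C)" "j < dim_col (?M vs * C)"
      then have ij: "i < d" "j < d" by (simp_all add: C_def)
      then have "hs ! i \<in> D" using hs by auto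
      then have "(hs ! i) (\<Sum>k<d. scale (c j k) (vs ! k)) = (\<Sum>k<d. c j k * (hs ! i) (vs ! k))"
        using module_hom.sum[of scale "(*)" "hs ! i"] dual_scale
        by (simp add: dual_space_def linear_iff_module_hom)
      then show "?M w $$ (i, j) = (?M vs * C) $$ (i, j)"
        using ij by (simp add: C_def scalar_prod_def c lessThan_atLeast0 mult.commute)
    qed (simp_all add: C_def)
    moreover have "det (?M vs * C) = det (?M vs) * det C"
      by (rule det_mult) (auto simp: C_def)
    ultimately show ?thesis using hs by (simp add: pairing_det_def)
  qed
  then show ?thesis by blast
qed

end

section \<open>Duality in top degree\<close>

text \<open>Finite dimension makes coordinates in a basis a finite family, and characteristic zero makes the
  factorials in \<open>mon_expansion_cong\<close> invertible.\<close>

locale finite_skew_apolarity =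
  skew_apolarity scale + finite_dimensional_vector_space scale Basis
  for scale :: "'k::field_char_0 \<Rightarrow> 'v::ab_group_add \<Rightarrow> 'v" and Basis
begin

definition coord :: "'v set \<Rightarrow> 'v \<Rightarrow> 'v \<Rightarrow> 'k" where
  "coord B b = (\<lambda>x. representation B x b)"

lemma coord_in_dual: "independent B \<Longrightarrow> span B = UNIV \<Longrightarrow> coord B b \<in> D"
  by (rule in_dualI) (simp_all add: coord_def representation_add representation_scale)

lemma vector_expansion:
  assumes "independent B" "span B = UNIV"
  shows "x = (\<Sum>b\<in>B. scale (coord B b x) b)"
  using assms sum_representation_eq[of B x B] finiteI_independent by (simp add: coord_def)

lemma dual_expansion:
  assumes B: "independent B" "span B = UNIV" and f: "f \<in> D"
  shows "f = (\<Sum>b\<in>B. dual_scale (f b) (coord B b))"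
proof
  fix x
  have apply_sum: "(\<Sum>b\<in>A. g b) y = (\<Sum>b\<in>A. g b y)" for g :: "'v \<Rightarrow> 'v \<Rightarrow> 'k" and A y
    by (induction A rule: infinite_finite_induct) simp_all
  have "f x = f (\<Sum>b\<in>B. scale (coord B b x) b)" using vector_expansion[OF B] by simp
  also have "\<dots> = (\<Sum>b\<in>B. f (scale (coord B b x) b))"
    using f module_hom.sum[of scale "(*)" f] by (simp add: dual_space_def linear_iff_module_hom)
  also have "\<dots> = (\<Sum>b\<in>B. dual_scale (f b) (coord B b)) x"
    by (simp add: apply_sum dual_scale[OF f] dual_scale_def mult.commute)
  finally show "f x = (\<Sum>b\<in>B. dual_scale (f b) (coord B b)) x" .
qed

text \<open>The converse of \<open>perp_annihilates_word\<close> in top degree. Expand \<open>p\<close> in words of coordinate forms for a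
  basis \<open>B\<close> that extends a basis \<open>B0\<close> of the span. A word that uses a coordinate outside \<open>B0\<close> lies in the
  ideal. The coefficient of any other word is the value of \<open>p\<close> at a word in the span, a multiple of its
  value at \<open>vs\<close>.\<close>

lemma perp_of_vanishing_pairing:
  assumes p: "p \<in> D.FA" "\<And>hs. hs \<in> Poly_Mapping.keys p \<Longrightarrow> length hs = d"
    and vs: "length vs = d"
    and zero: "linear_ext (\<lambda>hs. skew_action_word hs vs) p = 0"
  shows "D.cls p \<in> subspace_perp scale (span (set vs))"
proof -
  let ?W = "span (set vs)"
  let ?K = "{p \<in> D.FA. D.cls p \<in> subspace_perp scale ?W}"
  obtain B0 where B0: "B0 \<subseteq> ?W" "independent B0" "?W \<subseteq> span B0"
    using basis_exists[of ?W] by metis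
  define B where "B = extend_basis B0"
  have B: "independent B" "span B = UNIV" "B0 \<subseteq> B"
    using B0 independent_extend_basis span_extend_basis extend_basis_superset
    unfolding B_def by auto
  have fin: "finite B" using B(1) by (rule finiteI_independent)
  let ?Ws = "{w. set w \<subseteq> B \<and> length w = d}"
  have finWs: "finite ?Ws" using finite_lists_length_eq[OF fin] .
  have coord_vanish: "coord B b x = 0" if "b \<notin> B0" "x \<in> ?W" for b x
  proof -
    have "representation B x = representation B0 x"
      using that B B0 by (intro representation_extend) auto
    then show ?thesis using that representation_ne_zero[of B0 x b] by (auto simp: coord_def)
  qed
  have pd: "skew_action_word hs w = mon [] (pairing_det hs w)"
    if "hs \<in> Poly_Mapping.keys p" "length w = d" for hs w
    using that p by (intro skew_action_word_top) simp
  (* the pairing of p with w, as a scalar *)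
  define P where "P w = (\<Sum>hs\<in>Poly_Mapping.keys p. Poly_Mapping.lookup p hs * pairing_det hs w)" for w
  have P: "mon [] (P w) = linear_ext (\<lambda>hs. skew_action_word hs w) p" if "length w = d" for w
    unfolding linear_ext_def P_def mon_sum
    using pd that by (intro sum.cong) (auto simp: mon_mult)
  have "D.cong (\<Sum>hs\<in>Poly_Mapping.keys p. smul (Poly_Mapping.lookup p hs)
        (\<Sum>w\<in>?Ws. mon (map (coord B) w) (pairing_det (map (\<lambda>b f. f b) w) hs)))
      (\<Sum>hs\<in>Poly_Mapping.keys p. smul (Poly_Mapping.lookup p hs) (mon hs (fact d)))"
    using p
    by (intro D.cong_sum D.cong_smul D.mon_expansion_cong[unfolded of_nat_fact] fin coord_in_dual[OF B(1,2)]
        dual_expansion[OF B(1,2)]) (auto simp: free_algebra_simps)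
  also have "(\<Sum>hs\<in>Poly_Mapping.keys p. smul (Poly_Mapping.lookup p hs)
        (\<Sum>w\<in>?Ws. mon (map (coord B) w) (pairing_det (map (\<lambda>b f. f b) w) hs)))
      = (\<Sum>w\<in>?Ws. mon (map (coord B) w) (P w))"
    unfolding sum_distrib_left P_def mon_sum
    using p by (subst sum.swap) (auto intro!: sum.cong simp: mon_mult pairing_det_transpose)
  also have "(\<Sum>hs\<in>Poly_Mapping.keys p. smul (Poly_Mapping.lookup p hs) (mon hs (fact d)))
      = (\<Sum>hs\<in>Poly_Mapping.keys p. smul (fact d) (mon hs (Poly_Mapping.lookup p hs)))"
    by (simp add: mon_mult mult.commute)
  also have "\<dots> = smul (fact d) p"
    by (subst (3) free_algebra_sum_mon[of p]) (rule sum_distrib_left[symmetric])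
  finally have cong: "D.cong (\<Sum>w\<in>?Ws. mon (map (coord B) w) (P w)) (smul (fact d) p)" .
  have "mon (map (coord B) w) (P w) \<in> ?K" if w: "w \<in> ?Ws" for w
  proof (cases "set w \<subseteq> B0")
    case True
    then have "set w \<subseteq> span (set vs)" using B0 by auto
    then obtain c where "\<forall>hs\<in>lists D. length hs = d \<longrightarrow> pairing_det hs w = pairing_det hs vs * c"
      using pairing_det_span[OF vs] w by blast
    then have "P w = P vs * c"
      unfolding P_def sum_distrib_right using p
      by (intro sum.cong) (auto simp: free_algebra_simps)
    moreover have "mon [] (P vs) = (0 :: 'v list \<Rightarrow>\<^sub>0 'k)" using P[OF vs] zero by simp
    then have "P vs = 0" by (metis lookup_single_eq lookup_zero)
    ultimately show ?thesis using free.subspace_0[OF subspace_perp_representatives] by simp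
  next
    case False
    then obtain b where "b \<in> set w" "b \<notin> B0" by auto
    moreover have "map (coord B) w \<in> lists D" using coord_in_dual[OF B(1,2)] by auto
    ultimately show ?thesis
      using vanishing_word_in_perp[of "map (coord B) w" "coord B b" ?W] coord_vanish
      by (auto intro: mon_in_free_algebra)
  qed
  then have K: "(\<Sum>w\<in>?Ws. mon (map (coord B) w) (P w)) \<in> ?K"
    by (intro free.subspace_sum subspace_perp_representatives)
  moreover have "smul (fact d) p \<in> D.FA"
    using p by (intro free.subspace_scale subspace_free_algebra)
  moreover have "D.cls (\<Sum>w\<in>?Ws. mon (map (coord B) w) (P w)) = D.cls (smul (fact d) p)"
    using cong D.cls_eq_iff by blast
  ultimately have "smul (fact d) p \<in> ?K" by simp
  then have "smul (inverse (fact d)) (smul (fact d) p) \<in> ?K"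
    by (rule free.subspace_scale[OF subspace_perp_representatives])
  then show ?thesis by (simp add: mon_mult mon_Nil_one flip: mult.assoc)
qed

text \<open>A functional that kills \<open>U\<close> factors through the exterior algebra, as \<open>U\<close> contains the exterior ideal, and
  by the expansion it is in degree \<open>d\<close> the pairing with a form.\<close>

lemma separating_form:
  assumes q: "q \<notin> U" "\<And>vs. vs \<in> Poly_Mapping.keys q \<Longrightarrow> length vs = d"
    and U: "free.subspace U" "V.I \<subseteq> U"
  shows "\<exists>p\<in>D.FA. (\<forall>hs\<in>Poly_Mapping.keys p. length hs = d)
    \<and> (\<forall>vs. length vs = d \<longrightarrow> mon vs 1 \<in> U \<longrightarrow> linear_ext (\<lambda>hs. skew_action_word hs vs) p = 0)
    \<and> skew_action_free p q = mon [] 1"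
proof -
  obtain \<phi> where add: "\<And>x y. \<phi> (x + y) = \<phi> x + \<phi> y" and scale: "\<And>c x. \<phi> (smul c x) = c * \<phi> x"
    and U0: "\<And>x. x \<in> U \<Longrightarrow> \<phi> x = 0" and q1: "\<phi> q = 1"
    using free.separating_functional[OF U(1) q(1)] by blast
  have \<phi>0: "\<phi> 0 = 0" using U0 free.subspace_0[OF U(1)] by blast
  have \<phi>_sum: "\<phi> (sum g A) = (\<Sum>x\<in>A. \<phi> (g x))" for g :: "'z \<Rightarrow> _" and A
    by (induction A rule: infinite_finite_induct) (simp_all add: add \<phi>0)
  have \<phi>_cong: "\<phi> x = \<phi> y" if "V.cong x y" for x y
  proof -
    have "\<phi> (x - y) = 0" using that U(2) U0 by (auto simp: V.cong_def)
    then show ?thesis using add[of "x - y" y] by simp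
  qed
  have \<phi>_mon: "\<phi> (mon w c) = c * \<phi> (mon w 1)" for w c
    using scale[of c "mon w 1"] by (simp add: mon_mult)
  define B where "B = Basis"
  have B: "independent B" "span B = UNIV" "finite B"
    using independent_Basis span_Basis finite_Basis by (simp_all add: B_def)
  let ?Ws = "{w. set w \<subseteq> B \<and> length w = d}"
  (* the values of the functional are the coefficients; the division undoes the factorial of the expansion *)
  define p where "p = (\<Sum>w\<in>?Ws. mon (map (coord B) w) (\<phi> (mon w 1) / fact d))"
  have p_FA: "p \<in> D.FA"
    unfolding p_def using coord_in_dual[OF B(1,2)]
    by (intro free.subspace_sum[OF subspace_free_algebra] mon_in_free_algebra) auto
  have keys_p: "length hs = d" if "hs \<in> Poly_Mapping.keys p" for hs
    using that Poly_Mapping.keys_sum[of "\<lambda>w. mon (map (coord B) w) (\<phi> (mon w 1) / fact d)" ?Ws]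
    by (auto simp: p_def split: if_splits)
  have eval: "linear_ext (\<lambda>hs. skew_action_word hs vs) p = mon [] (\<phi> (mon vs 1))"
    if vs: "length vs = d" for vs
  proof -
    have "linear_ext (\<lambda>hs. skew_action_word hs vs) p
        = (\<Sum>w\<in>?Ws. mon [] (\<phi> (mon w 1) / fact d * pairing_det (map (coord B) w) vs))"
      unfolding p_def linear_ext_sum linear_ext_mon using vs
      by (intro sum.cong) (auto simp: skew_action_word_top mon_mult)
    also have "\<dots> = mon [] (\<phi> (\<Sum>w\<in>?Ws. mon (map (\<lambda>b. b) w) (pairing_det (map (coord B) w) vs)) / fact d)"
    proof -
      have "\<phi> (\<Sum>w\<in>?Ws. mon (map (\<lambda>b. b) w) (pairing_det (map (coord B) w) vs))
          = (\<Sum>w\<in>?Ws. pairing_det (map (coord B) w) vs * \<phi> (mon w 1))"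
        unfolding \<phi>_sum
        by (intro sum.cong refl) (simp only: list.map_ident \<phi>_mon[of _ "pairing_det _ _"])
      then show ?thesis
        by (simp add: sum_divide_distrib mon_sum mult.commute)
    qed
    (* the identity is kept under map to match the spanning family of the expansion *)
    also have "\<phi> (\<Sum>w\<in>?Ws. mon (map (\<lambda>b. b) w) (pairing_det (map (coord B) w) vs))
        = \<phi> (mon vs (fact d))"
      using vs by (intro \<phi>_cong V.mon_expansion_cong[unfolded of_nat_fact] B vector_expansion) auto
    also have "\<dots> = fact d * \<phi> (mon vs 1)" by (rule \<phi>_mon)
    finally show ?thesis by simp
  qed
  have "skew_action_free p q
      = (\<Sum>vs\<in>Poly_Mapping.keys q. mon [] (\<phi> (mon vs (Poly_Mapping.lookup q vs))))"
    unfolding skew_action_free_linear_right linear_ext_def[of _ q]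
    using q(2) by (intro sum.cong) (auto simp: eval mon_mult \<phi>_mon[of _ "Poly_Mapping.lookup q _"])
  also have "\<dots> = mon [] (\<phi> q)"
    by (subst (3) free_algebra_sum_mon[of q]) (simp add: \<phi>_sum mon_sum)
  finally have "skew_action_free p q = mon [] 1" by (simp add: q1)
  then show ?thesis using p_FA keys_p eval U0 by (intro bexI[of _ p]) auto
qed

lemma combination_imp_perp_subset_apolar:
  assumes t: "t = V.cls (\<Sum>i\<in>A. smul (a i) (mon (v i) 1))"
  shows "carrier D.E \<inter> (\<Inter>i\<in>A. subspace_perp scale (span (set (v i)))) \<subseteq> apolar scale t"
proof
  fix h assume h: "h \<in> carrier D.E \<inter> (\<Inter>i\<in>A. subspace_perp scale (span (set (v i))))"
  then obtain p0 where p0: "p0 \<in> D.FA" "h = D.cls p0" by (auto simp: D.carrier_E)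
  let ?s = "\<Sum>i\<in>A. smul (a i) (mon (v i) 1)"
  have action: "V.cls (skew_action_free p q) = V.I" if p: "p \<in> h" and q: "q \<in> t" for p q
  proof -
    have "p - p0 \<in> D.I" using p p0 by (simp add: D.mem_cls_iff)
    then have pFA: "p \<in> D.FA"
      using D.I_subset_FA p0(1) free.subspace_add[OF subspace_free_algebra, of "p - p0" D p0] by auto
    have "skew_action_free p (q - ?s) \<in> V.I"
      using q t by (intro skew_action_free_right_ideal pFA) (simp add: V.mem_cls_iff)
    moreover have "skew_action_free p ?s = 0"
    proof -
      have "linear_ext (\<lambda>hs. skew_action_word hs (v i)) p = 0" if "i \<in> A" for i
        using h p that by (intro perp_annihilates_word[of h "span (set (v i))"]) (auto intro: span_base)
      then show ?thesis
        by (simp add: skew_action_free_linear_right linear_ext_sum linear_ext_smul linear_ext_mon)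
    qed
    ultimately have "skew_action_free p q \<in> V.I"
      by (simp add: skew_action_free_linear_right linear_ext_diff)
    then show ?thesis using V.cls_eq_zero_iff V.zero_E by simp
  qed
  have "p0 \<in> h" "?s \<in> t"
    using p0 t by (simp_all add: D.mem_cls_iff V.mem_cls_iff free.subspace_0 D.subspace_I V.subspace_I)
  then have "skew_action scale h t = V.I"
    using action by (auto simp: skew_action_def)
  then show "h \<in> apolar scale t" using h by (simp add: apolar_def V.zero_E)
qed

lemma top_perp_subset_apolar_imp_combination:
  assumes len: "\<And>i. i \<in> A \<Longrightarrow> length (v i) = d" and A: "finite A"
    and q: "\<And>vs. vs \<in> Poly_Mapping.keys q \<Longrightarrow> length vs = d"
    and perp: "ext_power dual_scale D d \<inter> (\<Inter>i\<in>A. subspace_perp scale (span (set (v i))))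
      \<subseteq> apolar scale (V.cls q)"
  shows "\<exists>a. V.cls q = V.cls (\<Sum>i\<in>A. smul (a i) (mon (v i) 1))"
proof -
  define U where "U = free.span (V.I \<union> (\<lambda>i. mon (v i) 1) ` A)"
  have "q \<in> U"
  proof (rule ccontr)
    assume "q \<notin> U"
    then obtain p where p: "p \<in> D.FA" "\<forall>hs\<in>Poly_Mapping.keys p. length hs = d"
      and p_U: "\<And>vs. length vs = d \<Longrightarrow> mon vs 1 \<in> U \<Longrightarrow> linear_ext (\<lambda>hs. skew_action_word hs vs) p = 0"
      and pq: "skew_action_free p q = mon [] 1"
      using separating_form[of q U d] q
      by (auto simp: U_def free.subspace_span intro: free.span_base)
    have "D.cls p \<in> subspace_perp scale (span (set (v i)))" if "i \<in> A" for i
      using that len p by (intro perp_of_vanishing_pairing p_U) (auto simp: U_def intro: free.span_base)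
    moreover have "D.cls p \<in> ext_power dual_scale D d" using p by (auto simp: ext_power_def)
    ultimately have "skew_action scale (D.cls p) (V.cls q) = V.I"
      using perp by (auto simp: apolar_def V.zero_E)
    moreover have "p \<in> D.cls p" "q \<in> V.cls q" "mon [] 1 \<in> V.cls (mon [] 1)"
      by (simp_all add: D.mem_cls_iff V.mem_cls_iff free.subspace_0 D.subspace_I V.subspace_I)
    then have "mon [] 1 \<in> skew_action scale (D.cls p) (V.cls q)"
      unfolding skew_action_def using pq by (intro UN_I[of p] UN_I[of q]) simp_all
    ultimately have "mon [] 1 \<in> V.I" by simp
    then show False by (simp add: V.scalar_in_I)
  qed
  moreover have "free.span V.I = V.I"
    by (rule antisym[OF free.span_minimal[OF subset_refl V.subspace_I] free.span_superset])
  ultimately obtain x y where "q = x + y" "x \<in> V.I" "y \<in> free.span ((\<lambda>i. mon (v i) 1) ` A)"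
    unfolding U_def free.span_Un by auto
  moreover then obtain a where "y = (\<Sum>i\<in>A. smul (a i) (mon (v i) 1))"
    using free.span_image_sum[OF _ A] by blast
  ultimately have "V.cls q = V.cls (\<Sum>i\<in>A. smul (a i) (mon (v i) 1))"
    by (simp add: V.cls_eq_iff V.cong_def)
  then show ?thesis by blast
qed

end

theorem lemma12:
  fixes scale :: "'k::{alg_closed_field, field_char_0} \<Rightarrow> 'v::ab_group_add \<Rightarrow> 'v"
    and n d r :: nat
    and v :: "nat \<Rightarrow> 'v list"
    and t :: "('v list \<Rightarrow>\<^sub>0 'k) set"
  assumes "vector_space scale"
    and "vector_space.dim scale (UNIV :: 'v set) = n + 1"
    and "\<And>i. i \<in> {1..r} \<Longrightarrow> length (v i) = d"
    and "\<And>i. i \<in> {1..r} \<Longrightarrow> wedge scale UNIV (v i) \<noteq> \<zero>\<^bsub>Ext scale\<^esub>"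
    and "t \<in> ext_power scale UNIV d"
  shows
    "((\<exists>a :: nat \<Rightarrow> 'k.
         t = (\<Oplus>\<^bsub>Ext scale\<^esub> i \<in> {1..r}. ext_smult scale UNIV (a i) (wedge scale UNIV (v i))))
       \<longleftrightarrow> carrier (Ext_dual scale) \<inter> (\<Inter>i\<in>{1..r}. subspace_perp scale (module.span scale (set (v i))))
            \<subseteq> apolar scale t)
     \<and> (carrier (Ext_dual scale) \<inter> (\<Inter>i\<in>{1..r}. subspace_perp scale (module.span scale (set (v i))))
            \<subseteq> apolar scale t
       \<longleftrightarrow> ext_power dual_scale (dual_space scale) d
              \<inter> (\<Inter>i\<in>{1..r}. subspace_perp scale (module.span scale (set (v i)))
                             \<inter> ext_power dual_scale (dual_space scale) d)
            \<subseteq> apolar scale t \<inter> ext_power dual_scale (dual_space scale) d)"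
    (is "(?one \<longleftrightarrow> ?two) \<and> (?two \<longleftrightarrow> ?three)")
proof -
  interpret vector_space scale by fact
  obtain B where B: "independent B" "span B = UNIV"
    using independent_extend_basis[OF independent_empty] span_extend_basis[OF independent_empty] by blast
  (* the dimension of an infinite-dimensional space is 0 by default, so here there is a finite basis *)
  then have "card B = n + 1" using dim_eq_card[of B UNIV] assms(2) by simp
  then have "finite B" using card.infinite by fastforce
  then interpret finite_skew_apolarity scale B
    using B by unfold_locales auto
  obtain q where q: "t = V.cls q" "\<And>vs. vs \<in> Poly_Mapping.keys q \<Longrightarrow> length vs = d"
    using assms(5) by (auto simp: ext_power_def)
  have sum: "(\<Oplus>\<^bsub>Ext scale\<^esub> i \<in> {1..r}. ext_smult scale UNIV (a i) (wedge scale UNIV (v i)))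
      = V.cls (\<Sum>i\<in>{1..r}. smul (a i) (mon (v i) 1))" for a
    by (simp add: V.wedge_eq_cls V.ext_smult_cls V.cls_finsum free_algebra_simps(1))
  have "?one \<Longrightarrow> ?two"
    unfolding sum using combination_imp_perp_subset_apolar[where A = "{1..r}" and v = v] by blast
  moreover have "?two \<Longrightarrow> ?three"
    by (auto simp: ext_power_def D.carrier_E)
  moreover have "?three \<Longrightarrow> ?one"
    unfolding sum using top_perp_subset_apolar_imp_combination[of "{1..r}" v d q] assms(3) q by blast
  ultimately show ?thesis by blast
qed

end
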